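(* Let $n$ be a non-negative integer and let $$S_n=\sum_{k=1}^\infty \frac{\left(\psi\left(\frac{2k+2n+5}{4}\right)-\psi\left(\frac{2k+2n+3}{4}\right)\right)\left(\frac12-(-1)^k\right)}{(2k)^2}.$$ Then: (i) if $n=0$: $S_0=2-\pi+\frac{\pi^2}{6}-\frac{\pi^3}{96}$; (ii) if $n=1$: $S_1=-\frac{70}{27}+\frac{10\pi}{9}-\frac{\pi^2}{9}+\frac{\pi^3}{96}$; (iii) if $n$ is odd and $n\neq1$: $$\begin{aligned}S_n={}&-\frac{70}{27}+8\sum_{j=1}^{\frac{n-1}{2}}\frac{(2j+1)(2H_{4j+1}-H_{2j})}{(4j+3)^2(4j+1)^2}+2\sum_{j=1}^{\frac{n-1}{2}}\frac{1}{(4j+3)^3}-8\sum_{k=1}^{\frac{n-1}{2}}\sum_{j=0}^{2k}\frac{(-1)^j(16k^2+16k+5)}{(2j+1)(4k+3)^2(4k+1)^2}\\&+\left(\frac{10}{9}+\sum_{j=1}^{\frac{n-1}{2}}\frac{2(16j^2+16j+5)}{(4j+3)^2(4j+1)^2}\right)\pi-\left(\frac13+\sum_{j=1}^{\frac{n-1}{2}}\frac{1}{(4j+3)(4j+1)}\right)\frac{\pi^2}{3}+\frac{\pi^3}{96};\end{aligned}$$ (iv) if $n$ is even: $$\begin{aligned}S_n={}&2+16\sum_{j=0}^{\frac{n-2}{2}}\frac{(j+1)(2H_{4j+3}-H_{2j+1})}{(4j+5)^2(4j+3)^2}+2\sum_{j=0}^{\frac{n-2}{2}}\frac{1}{(4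j+5)^3}+8\sum_{k=0}^{\frac{n-2}{2}}\sum_{j=0}^{2k+1}\frac{(-1)^j(16k^2+32k+17)}{(2j+1)(4k+5)^2(4k+3)^2}\\&-\left(1+\sum_{j=0}^{\frac{n-2}{2}}\frac{2(16j^2+32j+17)}{(4j+5)^2(4j+3)^2}\right)\pi+\left(\frac12-\sum_{j=0}^{\frac{n-2}{2}}\frac{1}{(4j+5)(4j+3)}\right)\frac{\pi^2}{3}-\frac{\pi^3}{96}.\end{aligned}$$
   Context: $\psi=\Gamma'/\Gamma$ is the digamma function and $H_n=\sum_{k=1}^n\frac1k$ is the $n$-th harmonic number. Empty sums (such as $\sum_{j=0}^{-1}$) are $0$. *)

theory Defs
  imports "HOL-Analysis.Analysis"
begin

text \<open>
  The library defines \<open>Digamma\<close> by a series; on the positive reals, the only arguments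
  needed here, it is the logarithmic derivative of \<open>Gamma\<close>.
\<close>

lemma Digamma_eq_logderiv_Gamma:
  fixes x :: real
  assumes "x > 0"
  shows "Digamma x = deriv Gamma x / Gamma x"
proof -
  have nz: "x \<notin> \<int>\<^sub>\<le>\<^sub>0"
    using assms by (auto elim!: nonpos_Ints_cases)
  have "deriv Gamma x = Gamma x * Digamma x"
    by (rule DERIV_imp_deriv) (rule has_field_derivative_Gamma[OF nz])
  moreover have "Gamma x > 0"
    using assms by (rule Gamma_real_pos)
  ultimately show ?thesis
    by simp
qed

definition S_term :: "nat \<Rightarrow> nat \<Rightarrow> real" where
  "S_term n k =
     (Digamma ((2 * real k + 2 * real n + 5) / 4) - Digamma ((2 * real k + 2 * real n + 3) / 4))
       * (1 / 2 - (- 1) ^ k) / (2 * real k) ^ 2"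

text \<open>The summation index starts at 1, hence the shift by \<open>Suc\<close>.\<close>

definition S :: "nat \<Rightarrow> real" where
  "S n = (\<Sum>k. S_term n (Suc k))"

end

theory Submission
  imports Defs "HOL-Complex_Analysis.Cauchy_Integral_Theorem" "HOL-Real_Asymp.Real_Asymp"
begin

text \<open>
  With \<open>c\<^sub>k = (1/2 - (-1)^k) / k\<^sup>2\<close> and \<open>P t = \<Sum>k. c\<^sub>k t^(2k)\<close>, the integral representation
  \<open>\<psi>((2m+5)/4) - \<psi>((2m+3)/4) = 4 \<integral> t^(2m+2) / (1+t\<^sup>2)\<close> over \<open>[0,1]\<close> gives
  \<open>S n = \<integral> t^(2n+2) P t / (1+t\<^sup>2)\<close>. Hence \<open>S n + S (n+1)\<close> is the elementary moment
  \<open>\<integral> t^(2n+2) P t\<close>, and everything follows by induction from \<open>S 0\<close>.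

  For \<open>S 0\<close>, integration by parts reduces \<open>\<integral> P t / (1+t\<^sup>2)\<close> to
  \<open>\<integral> arctan t (2 ln (1+t\<^sup>2) - ln (1-t\<^sup>2)) / t = \<pi>\<^sup>3/32\<close>. The two halves are
  not evaluated separately; two relations make their combination collapse. Interchanging the
  order in a double integral expresses
  \<open>\<integral> arctan t ln (1-t\<^sup>2) / t\<close> by \<open>\<integral> ln t (arctan t / t - ln 2) / (1+t\<^sup>2)\<close>, and Cauchy's theorem
  for \<open>Ln ((1+z)/2) Ln ((1+z)/(1-z)) / z\<close> on the quarter disc relates
  \<open>\<integral> arctan t ln (1+t\<^sup>2) / t\<close> to \<open>\<integral> ln t ln (1+t\<^sup>2) / (1+t\<^sup>2)\<close>. What remains is
  \<open>\<Sum>k. (-1)^k / (2k+1)\<^sup>3 = \<pi>\<^sup>3/32\<close>, obtained from the reflection formula of the polygamma function.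
\<close>

subsection \<open>Integrals over open intervals and power series\<close>

lemma continuous_on_Icc_extension:
  fixes f :: "real \<Rightarrow> real"
  assumes "a < b"
    and cont: "\<And>x. a < x \<Longrightarrow> x < b \<Longrightarrow> isCont f x"
    and A: "(f \<longlongrightarrow> A) (at_right a)" and B: "(f \<longlongrightarrow> B) (at_left b)"
  shows "continuous_on {a..b} (\<lambda>x. if x = a then A else if x = b then B else f x)"
    (is "continuous_on _ ?G")
proof (rule continuous_on_IccI)
  have "(?G \<longlongrightarrow> A) (at_right a)"
  proof (rule Lim_transform_eventually[OF A])
    show "\<forall>\<^sub>F x in at_right a. f x = ?G x"
      using eventually_at_right_real[OF \<open>a < b\<close>] by eventually_elim auto
  qed
  then show "(?G \<longlongrightarrow> ?G a) (at_right a)" by simp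
  have "(?G \<longlongrightarrow> B) (at_left b)"
  proof (rule Lim_transform_eventually[OF B])
    show "\<forall>\<^sub>F x in at_left b. f x = ?G x"
      using eventually_at_left_real[OF \<open>a < b\<close>] by eventually_elim auto
  qed
  then show "(?G \<longlongrightarrow> ?G b) (at_left b)" using \<open>a < b\<close> by simp
  show "?G \<midarrow>x\<rightarrow> ?G x" if "a < x" "x < b" for x
  proof (rule Lim_transform_within_open)
    show "f \<midarrow>x\<rightarrow> ?G x" using cont[OF that] that by (auto simp: isCont_def)
    show "open {a<..<b}" "x \<in> {a<..<b}" using that by auto
    show "f y = ?G y" if "y \<in> {a<..<b}" for y using that by auto
  qed
qed (use \<open>a < b\<close> in auto)

text \<open>Most integrands below carry a factor such as \<open>ln t\<close> or
  \<open>ln (1 - t ^ 2)\<close>, or a quotient that is singular at an endpoint. Only one-sided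
  limits of the antiderivative are therefore required, and existence of the integral is part of the
  conclusion.\<close>

lemma fundamental_theorem_of_calculus_limits:
  fixes F f :: "real \<Rightarrow> real"
  assumes "a < b"
    and deriv: "\<And>x. a < x \<Longrightarrow> x < b \<Longrightarrow> (F has_real_derivative f x) (at x)"
    and A: "(F \<longlongrightarrow> A) (at_right a)" and B: "(F \<longlongrightarrow> B) (at_left b)"
  shows "(f has_integral B - A) {a..b}"
proof -
  \<comment> \<open>The endpoint values of \<open>F\<close> may be mere conventions of total
    functions, so they are overwritten by the limits.\<close>
  define G where "G x = (if x = a then A else if x = b then B else F x)" for x
  have "(f has_integral G b - G a) {a..b}"
  proof (rule fundamental_theorem_of_calculus_interior)
    show "continuous_on {a..b} G"
      unfolding G_def by (rule continuous_on_Icc_extension[OF \<open>a < b\<close> DERIV_isCont[OF deriv] A B])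
    show "(G has_vector_derivative f x) (at x)" if "x \<in> {a<..<b}" for x
      unfolding has_real_derivative_iff_has_vector_derivative[symmetric]
    proof (rule has_field_derivative_transform_within_open)
      show "(F has_real_derivative f x) (at x)" using deriv that by simp
      show "F y = G y" if "y \<in> {a<..<b}" for y using that by (auto simp: G_def)
    qed (use that in auto)
  qed (use \<open>a < b\<close> in auto)
  then show ?thesis using \<open>a < b\<close> by (simp add: G_def)
qed

lemma integrable_on_limits:
  fixes f :: "real \<Rightarrow> real"
  assumes "a < b"
    and "\<And>x. a < x \<Longrightarrow> x < b \<Longrightarrow> isCont f x"
    and "(f \<longlongrightarrow> A) (at_right a)" and "(f \<longlongrightarrow> B) (at_left b)"
  shows "f integrable_on {a..b}"
  using integrable_continuous_real[OF continuous_on_Icc_extension[OF assms]]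
  by (rule integrable_spike_finite[where S="{a, b}", rotated 2]) auto

lemma has_integral_power_01: "((\<lambda>t::real. t ^ k) has_integral 1 / (real k + 1)) {0..1}"
proof -
  have "((\<lambda>t::real. t ^ k) has_integral 1 ^ Suc k / (real k + 1) - 0 ^ Suc k / (real k + 1)) {0..1}"
  proof (rule fundamental_theorem_of_calculus)
    fix t :: real
    have "((\<lambda>t. t ^ Suc k / (real k + 1)) has_real_derivative t ^ k) (at t within {0..1})"
      by (rule DERIV_cong[OF DERIV_cdivide[OF DERIV_pow]]) (simp add: add.commute)
    then show "((\<lambda>t. t ^ Suc k / (real k + 1)) has_vector_derivative t ^ k) (at t within {0..1})"
      by (simp flip: has_real_derivative_iff_has_vector_derivative)
  qed auto
  then show ?thesis by simp
qed

section \<open>Power series with absolutely summable coefficients on the closed unit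
  interval\<close>

context
  fixes c :: "nat \<Rightarrow> real" and f :: "real \<Rightarrow> real"
  assumes summable_c: "summable (\<lambda>k. \<bar>c k\<bar>)" and f_def: "\<And>x. f x = (\<Sum>k. c k * x ^ k)"
begin

lemma abs_summable_powser_bound:
  assumes "\<bar>x\<bar> \<le> 1" shows "norm (c k * x ^ k) \<le> \<bar>c k\<bar>"
  using power_le_one[of "\<bar>x\<bar>" k] assms by (auto simp: abs_mult power_abs intro!: mult_left_le)

lemma abs_summable_powser_sums:
  assumes "\<bar>x\<bar> \<le> 1" shows "(\<lambda>k. c k * x ^ k) sums f x"
  unfolding f_def
  by (rule summable_sums, rule summable_comparison_test'[OF summable_c])
     (rule abs_summable_powser_bound[OF assms])

lemma abs_summable_powser_uniform_limit:
  "uniform_limit {-1..1} (\<lambda>n x. \<Sum>k<n. c k * x ^ k) f sequentially"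
  unfolding f_def
  by (rule Weierstrass_m_test[OF _ summable_c], rule abs_summable_powser_bound) auto

lemma abs_summable_powser_continuous: "continuous_on {-1..1} f"
  by (rule uniform_limit_theorem[OF _ abs_summable_powser_uniform_limit])
     (auto intro!: continuous_intros always_eventually)

text \<open>Stated through \<open>x\<close> times the derivative: the terms
  \<open>real k * c k * x ^ k\<close> keep the exponents of the original series, so the known
  logarithm and arctangent series can be plugged in without an index shift.\<close>

lemma abs_summable_powser_deriv:
  assumes x: "0 < \<bar>x\<bar>" "\<bar>x\<bar> < 1" and s: "(\<lambda>k. real k * c k * x ^ k) sums s"
  shows "(f has_real_derivative s / x) (at x)"
proof -
  have "(\<lambda>k. real (Suc k) * c (Suc k) * x ^ Suc k) sums s"
    using s by (subst sums_Suc_iff) simp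
  then have "(\<lambda>k. real (Suc k) * c (Suc k) * x ^ Suc k / x) sums (s / x)"
    by (rule sums_divide)
  moreover have "real (Suc k) * c (Suc k) * x ^ Suc k / x = diffs c k * x ^ k" for k
    using x by (auto simp: diffs_def)
  ultimately have "(\<Sum>k. diffs c k * x ^ k) = s / x"
    by (simp add: sums_iff)
  moreover have "((\<lambda>x. \<Sum>k. c k * x ^ k) has_real_derivative (\<Sum>k. diffs c k * x ^ k)) (at x)"
    by (rule termdiffs_strong'[where K = 1])
       (use x in \<open>auto intro!: sums_summable[OF abs_summable_powser_sums]\<close>)
  ultimately show ?thesis
    using f_def by presburger
qed

text \<open>A bound \<open>M\<close> of the continuous weight \<open>h\<close> on the compact
  interval gives the majorant \<open>M * \<bar>c k\<bar>\<close>, so the series converges uniformly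
  and may be integrated term by term.\<close>

lemma abs_summable_powser_integral:
  fixes h :: "real \<Rightarrow> real"
  assumes h: "continuous_on {0..1} h"
  shows "(\<lambda>k. c k * integral {0..1} (\<lambda>x. h x * x ^ (2 * k)))
           sums integral {0..1} (\<lambda>x. h x * f (x ^ 2))"
proof -
  have "bounded (h ` {0..1})"
    by (rule compact_imp_bounded[OF compact_continuous_image[OF h]]) auto
  then obtain M where M: "\<And>x. x \<in> {0..1} \<Longrightarrow> \<bar>h x\<bar> \<le> M"
    unfolding bounded_iff by (metis imageI real_norm_def)
  let ?g = "\<lambda>k x. c k * (h x * x ^ (2 * k))"
  have "uniform_limit {0..1} (\<lambda>n x. \<Sum>k<n. ?g k x) (\<lambda>x. \<Sum>k. ?g k x) sequentially"
  proof (rule Weierstrass_m_test)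
    show "summable (\<lambda>k. M * \<bar>c k\<bar>)" using summable_c by (rule summable_mult)
    show "norm (?g k x) \<le> M * \<bar>c k\<bar>" if "x \<in> {0..1}" for k x
    proof -
      have "norm (?g k x) = \<bar>h x\<bar> * (\<bar>c k\<bar> * \<bar>x ^ (2 * k)\<bar>)" by (simp add: abs_mult)
      also have "\<dots> \<le> M * (\<bar>c k\<bar> * 1)"
        using that M[OF that] by (intro mult_mono) (auto simp: power_le_one order_trans[OF abs_ge_zero])
      finally show ?thesis by simp
    qed
  qed
  then obtain I J where I: "\<And>n. ((\<lambda>x. \<Sum>k<n. ?g k x) has_integral I n) {0..1}"
    and J: "((\<lambda>x. \<Sum>k. ?g k x) has_integral J) {0..1}" and lim: "I \<longlonglongrightarrow> J"
    by (rule uniform_limit_integral) (use h in \<open>auto intro!: continuous_intros\<close>)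
  have "(?g k has_integral c k * integral {0..1} (\<lambda>x. h x * x ^ (2 * k))) {0..1}" for k
    by (intro has_integral_mult_right integrable_integral integrable_continuous_real
        continuous_intros h)
  then have "((\<lambda>x. \<Sum>k<n. ?g k x) has_integral
      (\<Sum>k<n. c k * integral {0..1} (\<lambda>x. h x * x ^ (2 * k)))) {0..1}" for n
    by (intro has_integral_sum) auto
  then have "I = (\<lambda>n. \<Sum>k<n. c k * integral {0..1} (\<lambda>x. h x * x ^ (2 * k)))"
    using I has_integral_unique by blast
  moreover have "(\<Sum>k. ?g k x) = h x * f (x ^ 2)" if "x \<in> {0..1}" for x
  proof -
    have "(\<lambda>k. h x * (c k * (x ^ 2) ^ k)) sums (h x * f (x ^ 2))"
      using that by (intro sums_mult abs_summable_powser_sums) (auto simp: abs_le_iff power_le_one)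
    then show ?thesis by (simp add: sums_iff mult.left_commute flip: power_mult)
  qed
  then have "J = integral {0..1} (\<lambda>x. h x * f (x ^ 2))"
    using J by (metis (no_types, lifting) has_integral_cong integral_unique)
  ultimately show ?thesis using lim by (simp add: sums_def)
qed

end

subsection \<open>Reduction to moments\<close>

text \<open>The denominator \<open>(2 * real k) ^ 2\<close> of \<open>S_term\<close> is split as 4
  times \<open>real k ^ 2\<close>; the 4 cancels against the factor in \<open>beta_int\<close>.
  Division by zero gives \<open>S_coeff 0 = 0\<close>, so series may start at index 0.\<close>

definition S_coeff :: "nat \<Rightarrow> real" where
  "S_coeff k = (1 / 2 - (- 1) ^ k) / real k ^ 2"

text \<open>In terms of the dilogarithm this is Li_2(x)/2 - Li_2(-x).\<close>

definition S_gen :: "real \<Rightarrow> real" where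
  "S_gen x = (\<Sum>k. S_coeff k * x ^ k)"

lemma inverse_squares_sums': "(\<lambda>k. 1 / real k ^ 2) sums (pi ^ 2 / 6)"
  using inverse_squares_sums
  by (subst sums_Suc_iff[where f = "\<lambda>k. 1 / real k ^ 2" and s = "pi ^ 2 / 6", simplified, symmetric]) (simp add: add.commute)

lemma summable_abs_S_coeff: "summable (\<lambda>k. \<bar>S_coeff k\<bar>)"
proof (rule summable_comparison_test')
  show "summable (\<lambda>k. 3 / 2 * (1 / real k ^ 2))"
    using inverse_squares_sums' by (intro summable_mult) (rule sums_summable)
  show "norm \<bar>S_coeff k\<bar> \<le> 3 / 2 * (1 / real k ^ 2)" for k
    by (cases "even k") (auto simp: S_coeff_def abs_mult intro!: divide_right_mono)
qed

lemmas S_gen_sums = abs_summable_powser_sums[OF summable_abs_S_coeff S_gen_def]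
lemmas S_gen_continuous = abs_summable_powser_continuous[OF summable_abs_S_coeff S_gen_def]
lemmas S_gen_integral = abs_summable_powser_integral[OF summable_abs_S_coeff S_gen_def]

text \<open>The numerator \<open>1 / 2 - (- 1) ^ k\<close> is 3/2 minus 2 for even \<open>k\<close>,
  and the even terms of the series of inverse squares make up a quarter of its sum.\<close>

lemma S_gen_1: "S_gen 1 = pi ^ 2 / 6"
proof -
  have "(\<lambda>k. 1 / 4 * (1 / real k ^ 2)) sums (1 / 4 * (pi ^ 2 / 6))"
    by (intro sums_mult inverse_squares_sums')
  then have "(\<lambda>k. if even (2 * k) then 1 / real (2 * k) ^ 2 else 0) sums (pi ^ 2 / 24)"
    by (simp add: power_mult_distrib)
  then have "(\<lambda>k. if even k then 1 / real k ^ 2 else 0) sums (pi ^ 2 / 24)"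
    by (subst (asm) sums_mono_reindex[of "(*) 2" "\<lambda>k. if even k then 1 / real k ^ 2 else 0"])
      (auto simp: strict_mono_def elim!: evenE)
  then have "(\<lambda>k. 3 / 2 * (1 / real k ^ 2) - 2 * (if even k then 1 / real k ^ 2 else 0))
      sums (3 / 2 * (pi ^ 2 / 6) - 2 * (pi ^ 2 / 24))"
    by (intro sums_diff sums_mult inverse_squares_sums')
  moreover have "3 / 2 * (1 / real k ^ 2) - 2 * (if even k then 1 / real k ^ 2 else 0) = S_coeff k * 1 ^ k" for k
    by (auto simp: S_coeff_def divide_simps)
  ultimately have "(\<lambda>k. S_coeff k * 1 ^ k) sums (pi ^ 2 / 6)"
    by simp
  then show ?thesis
    using S_gen_sums[of 1] sums_unique2 by fastforce
qed

text \<open>Multiplying \<open>S_coeff k\<close> by \<open>k\<close> leaves one power of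
  \<open>k\<close> in the denominator, which gives the coefficients of a combination of two
  logarithm series.\<close>

lemma S_gen_deriv:
  assumes "0 < x" "x < 1"
  shows "(S_gen has_real_derivative (ln (1 + x) - ln (1 - x) / 2) / x) (at x)"
proof (rule abs_summable_powser_deriv[OF summable_abs_S_coeff S_gen_def])
  have "(\<lambda>k. - ((- x) ^ k) / real k - (- (x ^ k) / real k) / 2) sums (ln (1 + x) - ln (1 - x) / 2)"
    using ln_series'[of x] ln_series'[of "- x"] assms by (intro sums_diff sums_divide) auto
  moreover have "- ((- x) ^ k) / real k - (- (x ^ k) / real k) / 2 = real k * S_coeff k * x ^ k" for k
    by (cases "k = 0") (auto simp: S_coeff_def power_minus[of x] field_simps power2_eq_square)
  ultimately show "(\<lambda>k. real k * S_coeff k * x ^ k) sums (ln (1 + x) - ln (1 - x) / 2)"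
    by simp
qed (use assms in auto)

lemma S_gen_sq_deriv:
  assumes "0 < x" "x < 1"
  shows "((\<lambda>x. S_gen (x ^ 2)) has_real_derivative (2 * ln (1 + x ^ 2) - ln (1 - x ^ 2)) / x) (at x)"
proof -
  have "((\<lambda>x. S_gen (x ^ 2)) has_real_derivative
      ((ln (1 + x ^ 2) - ln (1 - x ^ 2) / 2) / x ^ 2) * (2 * x)) (at x)"
    using assms
    by (intro DERIV_chain2[OF S_gen_deriv] derivative_eq_intros) (auto simp: power_less_one_iff)
  then show ?thesis
    by (rule DERIV_cong) (use assms in \<open>simp add: field_simps power2_eq_square\<close>)
qed

lemma S_gen_sq_continuous: "continuous_on {0..1} (\<lambda>x. S_gen (x ^ 2))"
  by (rule continuous_on_compose2[OF S_gen_continuous])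
     (auto intro!: continuous_intros simp: power_le_one order_trans[of "-1" 0])

lemma S_gen_sq_tendsto:
  "((\<lambda>x. S_gen (x ^ 2)) \<longlongrightarrow> S_gen 0) (at_right 0)"
  "((\<lambda>x. S_gen (x ^ 2)) \<longlongrightarrow> pi ^ 2 / 6) (at_left 1)"
  using continuous_on_Icc_at_rightD[OF S_gen_sq_continuous] continuous_on_Icc_at_leftD[OF S_gen_sq_continuous]
  by (auto simp: S_gen_1)

text \<open>With \<open>u = t ^ 2\<close> this becomes twice Nielsen's beta function at
  \<open>m + 3/2\<close>, which explains the link to a digamma difference.\<close>

definition beta_int :: "nat \<Rightarrow> real" where
  "beta_int m = 4 * integral {0..1} (\<lambda>t. t ^ (2 * m + 2) / (1 + t ^ 2))"

lemma beta_int_integrable: "(\<lambda>t::real. t ^ k / (1 + t ^ 2)) integrable_on {0..1}"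
  by (rule integrable_continuous_real) (auto intro!: continuous_intros simp: add_nonneg_eq_0_iff)

text \<open>Adding the exponents \<open>k\<close> and \<open>k + 2\<close> cancels the denominator.
  This one identity drives both the recurrence of \<open>beta_int\<close> and that of
  \<open>S\<close>.\<close>

lemma power_div_one_plus_square_add:
  fixes t :: real
  shows "t ^ k / (1 + t ^ 2) + t ^ (k + 2) / (1 + t ^ 2) = t ^ k"
proof -
  have "1 + t ^ 2 \<noteq> 0" by (simp add: add_nonneg_eq_0_iff)
  moreover have "t ^ k + t ^ (k + 2) = t ^ k * (1 + t ^ 2)"
    unfolding power_add by (simp add: distrib_left)
  ultimately show ?thesis
    unfolding add_divide_distrib[symmetric] by simp
qed

lemma beta_int_Suc: "beta_int m + beta_int (Suc m) = 4 / (2 * real m + 3)"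
proof -
  have "integral {0..1} (\<lambda>t::real. t ^ (2 * m + 2) / (1 + t ^ 2)) + integral {0..1} (\<lambda>t. t ^ (2 * Suc m + 2) / (1 + t ^ 2))
    = integral {0..1} (\<lambda>t. t ^ (2 * m + 2) / (1 + t ^ 2) + t ^ (2 * Suc m + 2) / (1 + t ^ 2))"
    by (rule integral_add[symmetric]) (rule beta_int_integrable)+
  also have "(\<lambda>t::real. t ^ (2 * m + 2) / (1 + t ^ 2) + t ^ (2 * Suc m + 2) / (1 + t ^ 2)) = (\<lambda>t. t ^ (2 * m + 2))"
  proof
    show "t ^ (2 * m + 2) / (1 + t ^ 2) + t ^ (2 * Suc m + 2) / (1 + t ^ 2) = t ^ (2 * m + 2)" for t :: real
      using power_div_one_plus_square_add[of t "2 * m + 2"] by simp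
  qed
  also have "integral {0..1} (\<lambda>t::real. t ^ (2 * m + 2)) = 1 / (2 * real m + 3)"
    using integral_unique[OF has_integral_power_01[of "2 * m + 2"]] by (simp add: algebra_simps)
  finally show ?thesis by (simp add: beta_int_def)
qed

lemma beta_int_nonneg: "beta_int m \<ge> 0"
  unfolding beta_int_def by (intro mult_nonneg_nonneg integral_nonneg beta_int_integrable) auto

lemma beta_int_0: "beta_int 0 = 4 - pi"
proof -
  have "((\<lambda>t::real. t ^ 2 / (1 + t ^ 2)) has_integral (1 - arctan 1) - (0 - arctan 0)) {0..1}"
  proof (rule fundamental_theorem_of_calculus)
    fix t :: real
    have "1 + t ^ 2 > 0" by (simp add: add_pos_nonneg)
    then have "((\<lambda>t. t - arctan t) has_real_derivative t ^ 2 / (1 + t ^ 2)) (at t within {0..1})"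
      by (auto intro!: derivative_eq_intros simp: divide_simps)
    then show "((\<lambda>t. t - arctan t) has_vector_derivative t ^ 2 / (1 + t ^ 2)) (at t within {0..1})"
      by (simp flip: has_real_derivative_iff_has_vector_derivative)
  qed auto
  from integral_unique[OF this] show ?thesis
    by (simp add: beta_int_def arctan_one power2_eq_square)
qed

text \<open>Unrolling the recurrence produces partial sums of the Leibniz series for
  \<open>pi\<close>; they become the inner alternating sums of the final formulas.\<close>

lemma beta_int_eq: "beta_int m = (- 1) ^ m * (4 * (\<Sum>j\<le>m. (- 1) ^ j / (2 * real j + 1)) - pi)"
proof (induction m)
  case 0
  then show ?case by (simp add: beta_int_0)
next
  case (Suc m)
  have "(-1::real) ^ Suc m * (-1) ^ Suc m = 1"
    by (simp flip: power_add)
  then show ?case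
    using Suc.IH beta_int_Suc[of m] by (simp add: algebra_simps)
qed

text \<open>
  Both sides satisfy \<open>D m + D (m + 1) = 4 / (2 m + 3)\<close> and are nonnegative, hence tend to \<open>0\<close>;
  the recurrence preserves the absolute value of their difference.
\<close>

lemma Digamma_diff_eq_beta_int:
  "Digamma ((2 * real m + 5) / 4) - Digamma ((2 * real m + 3) / 4) = beta_int m"
proof -
  define D where "D m = Digamma ((2 * real m + 5) / 4) - Digamma ((2 * real m + 3) / 4)" for m
  have D_nonneg: "D m \<ge> 0" for m
    unfolding D_def using Digamma_real_mono[of "(2 * real m + 3) / 4" "(2 * real m + 5) / 4"] by simp
  \<comment> \<open>The value at \<open>(2 * real m + 5) / 4\<close> cancels in the sum, leaving one
    instance of the functional equation of \<open>Digamma\<close>.\<close>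
  have D_Suc: "D m + D (Suc m) = 4 / (2 * real m + 3)" for m
    using Digamma_plus1[of "(2 * real m + 3) / 4"]
    by (simp add: D_def field_simps)
  have "\<bar>D m - beta_int m\<bar> = \<bar>D (m + k) - beta_int (m + k)\<bar>" for k
  proof (induction k)
    case (Suc k)
    then show ?case using D_Suc[of "m + k"] beta_int_Suc[of "m + k"] by simp
  qed simp
  moreover have "\<bar>D (m + k) - beta_int (m + k)\<bar> \<le> 4 / (2 * real (m + k) + 3)" for k
    using D_Suc[of "m + k"] beta_int_Suc[of "m + k"] D_nonneg beta_int_nonneg
    by (smt (verit))
  ultimately have "\<bar>D m - beta_int m\<bar> \<le> 4 / (2 * real (m + k) + 3)" for k
    by presburger
  moreover have "(\<lambda>k. 4 / (2 * real (m + k) + 3)) \<longlonglongrightarrow> 0"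
    by real_asymp
  ultimately have "\<bar>D m - beta_int m\<bar> \<le> 0"
    by (intro LIMSEQ_le_const) auto
  then show ?thesis by (simp add: D_def)
qed

text \<open>The powers \<open>t ^ (2 * n + 2)\<close> and \<open>t ^ (2 * k)\<close> merge, so each
  termwise integral is \<open>beta_int (n + k) / 4\<close>. Summability of the series comes for
  free.\<close>

lemma S_term_sums:
  "(\<lambda>k. S_term n (Suc k)) sums integral {0..1} (\<lambda>t. t ^ (2 * n + 2) / (1 + t ^ 2) * S_gen (t ^ 2))"
proof -
  have "(\<lambda>k. S_coeff k * integral {0..1} (\<lambda>t. t ^ (2 * n + 2) / (1 + t ^ 2) * t ^ (2 * k)))
      sums integral {0..1} (\<lambda>t. t ^ (2 * n + 2) / (1 + t ^ 2) * S_gen (t ^ 2))"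
    by (rule S_gen_integral) (auto intro!: continuous_intros simp: add_nonneg_eq_0_iff)
  moreover have "S_coeff k * integral {0..1} (\<lambda>t. t ^ (2 * n + 2) / (1 + t ^ 2) * t ^ (2 * k)) = S_term n k" for k
  proof -
    have "S_term n k = beta_int (n + k) / 4 * S_coeff k"
    proof -
      have "2 * real k + 2 * real n + 5 = 2 * real (n + k) + 5"
        "2 * real k + 2 * real n + 3 = 2 * real (n + k) + 3" by auto
      then have "S_term n k = beta_int (n + k) * (1 / 2 - (- 1) ^ k) / (2 * real k) ^ 2"
        using Digamma_diff_eq_beta_int[of "n + k"] by (simp only: S_term_def)
      then show ?thesis
        by (simp add: S_coeff_def power_mult_distrib)
    qed
    moreover have "(\<lambda>t::real. t ^ (2 * n + 2) / (1 + t ^ 2) * t ^ (2 * k)) = (\<lambda>t. t ^ (2 * (n + k) + 2) / (1 + t ^ 2))"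
      by (simp add: power_add algebra_simps)
    ultimately show ?thesis
      unfolding beta_int_def by simp
  qed
  ultimately have "S_term n sums integral {0..1} (\<lambda>t. t ^ (2 * n + 2) / (1 + t ^ 2) * S_gen (t ^ 2))"
    by (simp only:)
  \<comment> \<open>Division by zero makes the term at index 0 vanish, which reconciles the series
    from 0 with the shifted one.\<close>
  moreover have "S_term n 0 = 0" by (simp add: S_term_def)
  ultimately show ?thesis by (subst sums_Suc_iff) simp
qed

text \<open>The closed form of the integral of \<open>t ^ (2 * m) * S_gen (t ^ 2)\<close> over the
  unit interval, as shown in \<open>has_integral_power_S_gen\<close>.\<close>

definition S_gen_moment :: "nat \<Rightarrow> real" where
  "S_gen_moment m = pi ^ 2 / (6 * (2 * real m + 1))
     - (2 * harm (2 * m + 1) - harm m - beta_int m) / (2 * real m + 1) ^ 2"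

text \<open>Raising \<open>m\<close> by one adds \<open>2 * t ^ (2 * m + 2)\<close> to the
  integrand, whose integral \<open>2 / (2 * m + 3)\<close> is exactly the increment of the harmonic
  expression. At \<open>t = 1\<close> the quotient is 0/0, hence the exceptional point.\<close>

lemma has_integral_geometric:
  "((\<lambda>t::real. 2 * t * (1 - t ^ (2 * m + 1)) / (1 - t ^ 2)) has_integral
     2 * harm (2 * m + 1) - harm m - 2 * ln 2) {0..1}"
proof (induction m)
  case 0
  have "((\<lambda>t::real. 2 - 2 / (1 + t)) has_integral (2 * 1 - 2 * ln (1 + 1)) - (2 * 0 - 2 * ln (1 + 0))) {0..1}"
    by (rule fundamental_theorem_of_calculus)
       (auto intro!: derivative_eq_intros simp flip: has_real_derivative_iff_has_vector_derivative)
  then have "((\<lambda>t::real. 2 - 2 / (1 + t)) has_integral (2 - 2 * ln 2)) {0..1}"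
    by simp
  then have "((\<lambda>t::real. 2 * t * (1 - t) / (1 - t ^ 2)) has_integral (2 - 2 * ln 2)) {0..1}"
  proof (rule has_integral_spike_finite[rotated 2])
    show "2 * t * (1 - t) / (1 - t ^ 2) = 2 - 2 / (1 + t)" if "t \<in> {0..1} - {1}" for t :: real
    proof -
      have "1 - t ^ 2 = (1 - t) * (1 + t)" by (simp add: power2_eq_square algebra_simps)
      then show ?thesis using that by (simp add: divide_simps)
    qed
  qed auto
  then show ?case by (simp add: harm_expand)
next
  case (Suc m)
  have "((\<lambda>t::real. 2 * t * (1 - t ^ (2 * m + 1)) / (1 - t ^ 2) + 2 * t ^ (2 * m + 2)) has_integral
     2 * harm (2 * m + 1) - harm m - 2 * ln 2 + 2 * (1 / (real (2 * m + 2) + 1))) {0..1}"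
    by (intro has_integral_add Suc.IH has_integral_mult_right has_integral_power_01)
  then have "((\<lambda>t::real. 2 * t * (1 - t ^ (2 * Suc m + 1)) / (1 - t ^ 2)) has_integral
     2 * harm (2 * m + 1) - harm m - 2 * ln 2 + 2 * (1 / (real (2 * m + 2) + 1))) {0..1}"
  proof (rule has_integral_spike_finite[rotated 2])
    show "2 * t * (1 - t ^ (2 * Suc m + 1)) / (1 - t ^ 2)
        = 2 * t * (1 - t ^ (2 * m + 1)) / (1 - t ^ 2) + 2 * t ^ (2 * m + 2)" if "t \<in> {0..1} - {1}" for t :: real
    proof -
      have "1 - t ^ 2 \<noteq> 0" using that by (auto simp: power2_eq_1_iff)
      then show ?thesis by (simp add: divide_simps power2_eq_square algebra_simps)
    qed
  qed auto
  moreover have "2 * harm (2 * Suc m + 1) - harm (Suc m) - 2 * ln 2 =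
      2 * harm (2 * m + 1) - harm m - 2 * ln 2 + 2 * (1 / (real (2 * m + 2) + 1))"
    by (simp add: harm_Suc inverse_eq_divide divide_simps) (simp add: algebra_simps)
  ultimately show ?case by presburger
qed

text \<open>Two integrations by parts: \<open>A\<close> moves the derivative onto
  \<open>S_gen\<close> and leaves logarithms, \<open>B\<close> turns these into the rational
  integrands of \<open>beta_int\<close> and \<open>has_integral_geometric\<close>. The two
  occurrences of \<open>2 * ln 2\<close> cancel.\<close>

lemma has_integral_power_S_gen:
  "((\<lambda>t. t ^ (2 * m) * S_gen (t ^ 2)) has_integral S_gen_moment m) {0..1}"
proof -
  define c where "c = 2 * real m + 1"
  have c: "c > 0" by (simp add: c_def)
  define l where "l t = 2 * ln (1 + t ^ 2) - ln (1 - t ^ 2)" for t :: real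
  have A: "((\<lambda>t. c * (t ^ (2 * m) * S_gen (t ^ 2)) + t ^ (2 * m) * l t) has_integral pi ^ 2 / 6 - 0) {0..1}"
  proof (rule fundamental_theorem_of_calculus_limits)
    show "((\<lambda>t. t ^ (2 * m + 1) * S_gen (t ^ 2)) has_real_derivative
       c * (t ^ (2 * m) * S_gen (t ^ 2)) + t ^ (2 * m) * l t) (at t)" if "0 < t" "t < 1" for t
    proof (rule DERIV_cong[OF DERIV_mult[OF DERIV_pow S_gen_sq_deriv[OF that]]])
      show "real (2 * m + 1) * t ^ (2 * m + 1 - Suc 0) * S_gen (t ^ 2)
          + (2 * ln (1 + t ^ 2) - ln (1 - t ^ 2)) / t * t ^ (2 * m + 1)
        = c * (t ^ (2 * m) * S_gen (t ^ 2)) + t ^ (2 * m) * l t"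
        unfolding l_def[symmetric] using that by (simp add: c_def add.commute)
    qed
    have "((\<lambda>t. t ^ (2 * m + 1) * S_gen (t ^ 2)) \<longlongrightarrow> 0 ^ (2 * m + 1) * S_gen 0) (at_right 0)"
      by (intro tendsto_intros S_gen_sq_tendsto)
    then show "((\<lambda>t. t ^ (2 * m + 1) * S_gen (t ^ 2)) \<longlongrightarrow> 0) (at_right 0)" by simp
    have "((\<lambda>t. t ^ (2 * m + 1) * S_gen (t ^ 2)) \<longlongrightarrow> 1 ^ (2 * m + 1) * (pi ^ 2 / 6)) (at_left 1)"
      by (intro tendsto_intros S_gen_sq_tendsto)
    then show "((\<lambda>t. t ^ (2 * m + 1) * S_gen (t ^ 2)) \<longlongrightarrow> pi ^ 2 / 6) (at_left 1)" by simp
  qed auto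
  have B: "((\<lambda>t. c * (t ^ (2 * m) * l t) + 4 * (t ^ (2 * m + 2) / (1 + t ^ 2))
        - 2 * t * (1 - t ^ (2 * m + 1)) / (1 - t ^ 2)) has_integral 2 * ln 2 - 0) {0..1}"
  proof (rule fundamental_theorem_of_calculus_limits)
    \<comment> \<open>The constant of integration in \<open>1 - t ^ (2 * m + 1)\<close> is chosen to
      vanish at 1, where \<open>ln (1 - t ^ 2)\<close> blows up.\<close>
    let ?W = "\<lambda>t::real. 2 * t ^ (2 * m + 1) * ln (1 + t ^ 2) + (1 - t ^ (2 * m + 1)) * ln (1 - t ^ 2)"
    show "(?W has_real_derivative c * (t ^ (2 * m) * l t) + 4 * (t ^ (2 * m + 2) / (1 + t ^ 2))
        - 2 * t * (1 - t ^ (2 * m + 1)) / (1 - t ^ 2)) (at t)" if "0 < t" "t < 1" for t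
    proof -
      have "1 + t ^ 2 > 0" by (simp add: add_pos_nonneg)
      moreover have "1 - t ^ 2 > 0" using that by (simp add: power_less_one_iff)
      ultimately have "((\<lambda>t. 2 * u t * ln (1 + t ^ 2) + (1 - u t) * ln (1 - t ^ 2)) has_real_derivative
          2 * u' * ln (1 + t ^ 2) + 2 * u t * (2 * t / (1 + t ^ 2))
          - u' * ln (1 - t ^ 2) - (1 - u t) * (2 * t / (1 - t ^ 2))) (at t)"
        if "(u has_real_derivative u') (at t)" for u u'
        using that by (auto intro!: derivative_eq_intros simp: algebra_simps simp flip: add_divide_distrib)
      moreover have "((\<lambda>t. t ^ (2 * m + 1)) has_real_derivative c * t ^ (2 * m)) (at t)"
        by (rule DERIV_cong[OF DERIV_pow]) (simp add: c_def add.commute)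
      ultimately have "(?W has_real_derivative
          2 * (c * t ^ (2 * m)) * ln (1 + t ^ 2) + 2 * t ^ (2 * m + 1) * (2 * t / (1 + t ^ 2))
          - c * t ^ (2 * m) * ln (1 - t ^ 2) - (1 - t ^ (2 * m + 1)) * (2 * t / (1 - t ^ 2))) (at t)"
        by blast
      then show ?thesis
        by (rule DERIV_cong) (simp add: l_def algebra_simps)
    qed
    have "(?W \<longlongrightarrow> 2 * 0 ^ (2 * m + 1) * ln (1 + 0 ^ 2) + (1 - 0 ^ (2 * m + 1)) * ln (1 - 0 ^ 2)) (at_right 0)"
      by (intro tendsto_intros) auto
    then show "(?W \<longlongrightarrow> 0) (at_right 0)" by simp
    \<comment> \<open>Factoring \<open>1 - t\<close> out of \<open>1 - t ^ (2 * m + 1)\<close>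
      isolates a product with a limit that no longer depends on the symbolic exponent.\<close>
    have "((\<lambda>t::real. 2 * t ^ (2 * m + 1) * ln (1 + t ^ 2) + (\<Sum>i<2*m+1. t ^ i) * ((1 - t) * ln (1 - t ^ 2)))
        \<longlongrightarrow> 2 * 1 ^ (2 * m + 1) * ln (1 + 1 ^ 2) + (\<Sum>i<2*m+1. 1 ^ i) * 0) (at_left 1)"
    proof (intro tendsto_intros)
      show "((\<lambda>t::real. (1 - t) * ln (1 - t ^ 2)) \<longlongrightarrow> 0) (at_left 1)" by real_asymp
    qed auto
    moreover have "(\<Sum>i<2*m+1. t ^ i) * ((1 - t) * ln (1 - t ^ 2)) = (1 - t ^ (2 * m + 1)) * ln (1 - t ^ 2)" for t :: real
      unfolding one_diff_power_eq[of t "2 * m + 1"] by (simp only: mult_ac)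
    ultimately have "(?W \<longlongrightarrow> 2 * 1 ^ (2 * m + 1) * ln (1 + 1 ^ 2) + (\<Sum>i<2*m+1. 1 ^ i) * 0) (at_left 1)"
      by (simp only:)
    then show "(?W \<longlongrightarrow> 2 * ln 2) (at_left 1)"
      by simp
  qed auto
  have C: "((\<lambda>t. 4 * (t ^ (2 * m + 2) / (1 + t ^ 2))) has_integral beta_int m) {0..1}"
    unfolding beta_int_def by (intro has_integral_mult_right integrable_integral beta_int_integrable)
  \<comment> \<open>The integrand is the literal combination of \<open>A\<close>, \<open>B\<close>,
    \<open>C\<close> and the geometric integral; it collapses to
    \<open>t ^ (2 * m) * S_gen (t ^ 2)\<close>.\<close>
  have "((\<lambda>t. (1 / c) * ((c * (t ^ (2 * m) * S_gen (t ^ 2)) + t ^ (2 * m) * l t)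
       - (1 / c) * ((c * (t ^ (2 * m) * l t) + 4 * (t ^ (2 * m + 2) / (1 + t ^ 2))
        - 2 * t * (1 - t ^ (2 * m + 1)) / (1 - t ^ 2)) - 4 * (t ^ (2 * m + 2) / (1 + t ^ 2))
        + 2 * t * (1 - t ^ (2 * m + 1)) / (1 - t ^ 2)))) has_integral
      (1 / c) * ((pi ^ 2 / 6 - 0) - (1 / c) * ((2 * ln 2 - 0) - beta_int m +
        (2 * harm (2 * m + 1) - harm m - 2 * ln 2)))) {0..1}"
    by (intro has_integral_mult_right has_integral_diff has_integral_add A B C has_integral_geometric)
  moreover have "(1 / c) * ((pi ^ 2 / 6 - 0) - (1 / c) * ((2 * ln 2 - 0) - beta_int m +
        (2 * harm (2 * m + 1) - harm m - 2 * ln 2))) = S_gen_moment m"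
    unfolding S_gen_moment_def c_def[symmetric] using c by (simp add: divide_simps power2_eq_square)
  ultimately show ?thesis
    using c by (simp add: field_simps)
qed

lemma S_eq_integral: "S n = integral {0..1} (\<lambda>t. t ^ (2 * n + 2) / (1 + t ^ 2) * S_gen (t ^ 2))"
  using S_term_sums[of n] by (simp add: S_def sums_iff)

lemma S_integrable: "(\<lambda>t. t ^ k / (1 + t ^ 2) * S_gen (t ^ 2)) integrable_on {0..1}"
  by (intro integrable_continuous_real continuous_intros S_gen_sq_continuous)
     (auto simp: add_nonneg_eq_0_iff)

text \<open>For \<open>m = Suc n\<close> the two integrals are \<open>S n\<close> and
  \<open>S (Suc n)\<close>; for \<open>m = 0\<close> the first one is the extra integral from which
  \<open>S 0\<close> is computed.\<close>

lemma integral_power_div_S_gen_add: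
  "integral {0..1} (\<lambda>t. t ^ (2 * m) / (1 + t ^ 2) * S_gen (t ^ 2))
     + integral {0..1} (\<lambda>t. t ^ (2 * m + 2) / (1 + t ^ 2) * S_gen (t ^ 2)) = S_gen_moment m"
proof -
  have "(\<lambda>t. t ^ (2 * m) / (1 + t ^ 2) * S_gen (t ^ 2) + t ^ (2 * m + 2) / (1 + t ^ 2) * S_gen (t ^ 2))
      = (\<lambda>t. t ^ (2 * m) * S_gen (t ^ 2))"
  proof
    show "t ^ (2 * m) / (1 + t ^ 2) * S_gen (t ^ 2) + t ^ (2 * m + 2) / (1 + t ^ 2) * S_gen (t ^ 2)
      = t ^ (2 * m) * S_gen (t ^ 2)" for t
      using power_div_one_plus_square_add[of t "2 * m"] by (metis distrib_right)
  qed
  then show ?thesis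
    using integral_add[OF S_integrable[of "2 * m"] S_integrable[of "2 * m + 2"]]
      integral_unique[OF has_integral_power_S_gen[of m]] by simp
qed

lemma S_Suc: "S (Suc n) = S_gen_moment (Suc n) - S n"
  using integral_power_div_S_gen_add[of "Suc n"] by (simp add: S_eq_integral)

subsection \<open>The alternating sum of odd cubes\<close>

text \<open>Differentiate both sides of the reflection formula for
  \<open>rGamma z * rGamma (1 - z)\<close>, then divide by the product itself, a multiple of the
  sine that is nonzero off the integers.\<close>

lemma Digamma_reflection_complex:
  fixes z :: complex
  assumes z: "z \<notin> \<int>"
  shows "Digamma (1 - z) - Digamma z = of_real pi * cot (of_real pi * z)"
proof -
  have z': "z \<notin> \<int>\<^sub>\<le>\<^sub>0" "1 - z \<notin> \<int>\<^sub>\<le>\<^sub>0"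
    using z by (auto dest!: nonpos_Ints_Int)
  have s: "sin (of_real pi * z) \<noteq> 0"
    using z by (auto simp: sin_eq_0 mult.commute)
  have "((\<lambda>z. rGamma z * rGamma (1 - z)) has_field_derivative
      (- rGamma z * Digamma z) * rGamma (1 - z) + (- rGamma (1 - z) * Digamma (1 - z) * (0 - 1)) * rGamma z) (at z)"
    by (rule DERIV_mult[OF has_field_derivative_rGamma_no_nonpos_int[OF z'(1)]
          DERIV_chain2[of rGamma _ "\<lambda>z. 1 - z", OF has_field_derivative_rGamma_no_nonpos_int[OF z'(2)]]])
       (auto intro!: derivative_eq_intros)
  moreover have "(\<lambda>z::complex. rGamma z * rGamma (1 - z)) = (\<lambda>z. sin (of_real pi * z) / of_real pi)"
    by (intro ext rGamma_reflection_complex)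
  moreover have "((\<lambda>z::complex. sin (of_real pi * z) / of_real pi) has_field_derivative cos (of_real pi * z)) (at z)"
    by (auto intro!: derivative_eq_intros)
  ultimately have "(- rGamma z * Digamma z) * rGamma (1 - z) + (- rGamma (1 - z) * Digamma (1 - z) * (0 - 1)) * rGamma z
      = cos (of_real pi * z)"
    using DERIV_unique by fastforce
  then have "(Digamma (1 - z) - Digamma z) * (rGamma z * rGamma (1 - z)) = cos (of_real pi * z)"
    by (simp add: algebra_simps)
  then show ?thesis
    using s by (simp add: rGamma_reflection_complex cot_def field_simps)
qed

text \<open>The digamma reflection formula is differentiated twice. Each time the identity is
  transferred on the open complement of the integers, and uniqueness of derivatives compares the two
  sides.\<close>

lemma Polygamma_2_reflection_complex:
  fixes z :: complex
  assumes z: "z \<notin> \<int>"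
  shows "Polygamma 2 (1 - z) - Polygamma 2 z
    = 2 * of_real pi ^ 3 * cos (of_real pi * z) / sin (of_real pi * z) ^ 3"
proof -
  define A :: "complex set" where "A = - \<int>"
  have A: "open A" "z \<in> A" using z by (auto simp: A_def closed_Ints)
  have np: "w \<notin> \<int>\<^sub>\<le>\<^sub>0" "1 - w \<notin> \<int>\<^sub>\<le>\<^sub>0" if "w \<in> A" for w
    using that by (auto simp: A_def dest!: nonpos_Ints_Int)
  have s: "sin (of_real pi * w) \<noteq> 0" if "w \<in> A" for w
    using that by (auto simp: sin_eq_0 A_def mult.commute)
  have 1: "- Polygamma 1 (1 - w) - Polygamma 1 w = - (of_real pi ^ 2 / sin (of_real pi * w) ^ 2)" if w: "w \<in> A" for w
  proof -
    have "((\<lambda>w. Digamma (1 - w) - Digamma w) has_field_derivative Polygamma (Suc 0) (1 - w) * (0 - 1) - Polygamma (Suc 0) w) (at w)"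
      by (intro DERIV_diff DERIV_chain2[OF has_field_derivative_Polygamma] has_field_derivative_Polygamma)
         (use np[OF w] in \<open>auto intro!: derivative_eq_intros\<close>)
    moreover have "((\<lambda>w. Digamma (1 - w) - Digamma w) has_field_derivative - (of_real pi ^ 2 / sin (of_real pi * w) ^ 2)) (at w)"
    proof (rule has_field_derivative_transform_within_open[OF _ A(1) w])
      have "((\<lambda>w. of_real pi * cot (of_real pi * w)) has_field_derivative of_real pi * (- inverse (sin (of_real pi * w) ^ 2) * of_real pi)) (at w)"
        by (intro DERIV_cmult DERIV_chain2[OF DERIV_cot]) (use s[OF w] in \<open>auto intro!: derivative_eq_intros\<close>)
      then show "((\<lambda>w. of_real pi * cot (of_real pi * w)) has_field_derivative - (of_real pi ^ 2 / sin (of_real pi * w) ^ 2)) (at w)"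
        by (rule DERIV_cong) (simp add: power2_eq_square field_simps)
    qed (auto simp: A_def Digamma_reflection_complex)
    ultimately show ?thesis
      using DERIV_unique by fastforce
  qed
  have "((\<lambda>w. - Polygamma 1 (1 - w) - Polygamma 1 w) has_field_derivative - (Polygamma (Suc 1) (1 - z) * (0 - 1)) - Polygamma (Suc 1) z) (at z)"
    by (intro DERIV_diff DERIV_minus DERIV_chain2[OF has_field_derivative_Polygamma] has_field_derivative_Polygamma)
       (use np[OF A(2)] in \<open>auto intro!: derivative_eq_intros\<close>)
  moreover have "((\<lambda>w. - Polygamma 1 (1 - w) - Polygamma 1 w) has_field_derivative
      2 * of_real pi ^ 3 * cos (of_real pi * z) / sin (of_real pi * z) ^ 3) (at z)"
  proof (rule has_field_derivative_transform_within_open[OF _ A])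
    have "((\<lambda>w. - (of_real pi ^ 2 / sin (of_real pi * w) ^ 2)) has_field_derivative
        - ((0 * sin (of_real pi * z) ^ 2 - of_real pi ^ 2 * (2 * sin (of_real pi * z) * (cos (of_real pi * z) * of_real pi)))
         / (sin (of_real pi * z) ^ 2 * sin (of_real pi * z) ^ 2))) (at z)"
      using s[OF A(2)] by (intro DERIV_minus DERIV_divide) (auto intro!: derivative_eq_intros)
    then show "((\<lambda>w. - (of_real pi ^ 2 / sin (of_real pi * w) ^ 2)) has_field_derivative
      2 * of_real pi ^ 3 * cos (of_real pi * z) / sin (of_real pi * z) ^ 3) (at z)"
      by (rule DERIV_cong) (use s[OF A(2)] in \<open>simp add: field_simps power2_eq_square power3_eq_cube\<close>)
    show "- (of_real pi ^ 2 / sin (of_real pi * w) ^ 2) = - Polygamma 1 (1 - w) - Polygamma 1 w" if "w \<in> A" for w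
      using 1[OF that] by simp
  qed
  ultimately show ?thesis
    using DERIV_unique by (fastforce simp: numeral_2_eq_2)
qed

text \<open>Grouping the terms in pairs gives differences of cubes over \<open>4 * k + 1\<close> and
  \<open>4 * k + 3\<close>. These are polygamma series at 1/4 and 3/4, two arguments with sum 1, so
  reflection evaluates their difference.\<close>

lemma alternating_odd_cubes_sums: "(\<lambda>k. (- 1) ^ k / (2 * real k + 1) ^ 3) sums (pi ^ 3 / 32)"
proof -
  define f where "f k = (- 1) ^ k / (2 * real k + 1) ^ 3" for k
  have summable: "summable f"
  proof (rule summable_comparison_test')
    show "summable (\<lambda>k. inverse (real (Suc k)) ^ 3)"
      using summable_Suc_iff[of "\<lambda>k. inverse (real k) ^ 3"] inverse_power_summable[of 3, where 'a=real] by (simp add: power_inverse)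
    show "norm (f k) \<le> inverse (real (Suc k)) ^ 3" for k
      by (simp add: f_def abs_mult power_abs divide_inverse power_inverse)
  qed
  have P: "(\<lambda>k. inverse ((x + real k) ^ Suc 2)) sums ((- 1) ^ Suc 2 * Polygamma 2 x / fact 2)" if "x > 0" for x :: real
    using that by (intro Polygamma_LIMSEQ) auto
  have "(\<lambda>k. 1 / 64 * (inverse ((1 / 4 + real k) ^ Suc 2) - inverse ((3 / 4 + real k) ^ Suc 2))) sums
      (1 / 64 * ((- 1) ^ Suc 2 * Polygamma 2 (1 / 4) / fact 2 - (- 1) ^ Suc 2 * Polygamma 2 (3 / 4) / fact 2))"
    by (intro sums_mult sums_diff P) auto
  moreover have "1 / 64 * (inverse ((1 / 4 + real k) ^ Suc 2) - inverse ((3 / 4 + real k) ^ Suc 2)) = sum f {k * 2..<k * 2 + 2}" for k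
  proof -
    have "inverse ((c / 4 + real k) ^ Suc 2) = 64 / (c + 4 * real k) ^ 3" for c :: real
    proof -
      have "c / 4 + real k = (c + 4 * real k) / 4" by simp
      show ?thesis unfolding \<open>c / 4 + real k = (c + 4 * real k) / 4\<close> power_divide by simp
    qed
    then have "1 / 64 * (inverse ((1 / 4 + real k) ^ Suc 2) - inverse ((3 / 4 + real k) ^ Suc 2))
        = 1 / (1 + 4 * real k) ^ 3 - 1 / (3 + 4 * real k) ^ 3"
      by simp
    also have "\<dots> = f (k * 2) + f (k * 2 + 1)"
      by (simp add: f_def algebra_simps)
    finally show ?thesis by (simp add: numeral_2_eq_2)
  qed
  moreover have "(\<lambda>k. sum f {k * 2..<k * 2 + 2}) sums suminf f"
    by (rule sums_group[OF summable_sums[OF summable]]) simp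
  ultimately have "suminf f = 1 / 64 * ((- 1) ^ Suc 2 * Polygamma 2 (1 / 4) / fact 2 - (- 1) ^ Suc 2 * Polygamma 2 (3 / 4) / fact 2)"
    by (simp only: sums_unique2)
  then have "suminf f = 1 / 128 * (Polygamma 2 (3 / 4) - Polygamma 2 (1 / 4))"
    by (simp add: fact_numeral)
  moreover have "Polygamma 2 (3 / 4) - Polygamma 2 (1 / 4) = 4 * pi ^ 3"
  proof -
    have "complex_of_real (1 / 4) \<notin> \<int>"
      using fraction_not_in_Ints[where 'a = complex, of 4 1] by simp
    from Polygamma_2_reflection_complex[OF this]
    have "complex_of_real (Polygamma 2 (1 - 1 / 4) - Polygamma 2 (1 / 4)) =
        of_real (2 * pi ^ 3 * cos (pi * (1 / 4)) / sin (pi * (1 / 4)) ^ 3)"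
      using Polygamma_of_real[of "1 - 1 / 4" 2, where 'a = complex] Polygamma_of_real[of "1 / 4" 2, where 'a = complex]
      by (simp add: cos_of_real[symmetric] sin_of_real[symmetric])
    then have "Polygamma 2 (1 - 1 / 4) - Polygamma 2 (1 / 4) = 2 * pi ^ 3 * cos (pi * (1 / 4)) / sin (pi * (1 / 4)) ^ 3"
      by (simp only: of_real_eq_iff)
    then show ?thesis
      by (simp add: sin_45 cos_45 power3_eq_cube power_divide)
  qed
  ultimately have "suminf f = pi ^ 3 / 32" by simp
  then have "f sums (pi ^ 3 / 32)" using summable summable_sums by metis
  then show ?thesis unfolding f_def .
qed

subsection \<open>The contour integral\<close>

text \<open>Convexity provides primitives, and the branch point -1 lies outside. The branch point 1
  remains as a corner and needs a separate limit.\<close>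

definition quarter_disc :: "complex set" where
  "quarter_disc = cball 0 1 \<inter> {z. Re z \<ge> 0} \<inter> {z. Im z \<ge> 0}"

definition log_quot :: "complex \<Rightarrow> complex" where
  "log_quot z = Ln ((1 + z) / (1 - z))"

text \<open>
  The value at \<open>0\<close> fills in the removable singularity. The factor \<open>1 / 2\<close> makes the logarithmic
  singularity at \<open>1\<close> harmless.
\<close>

definition contour_fn :: "complex \<Rightarrow> complex" where
  "contour_fn z = (if z = 0 then - 2 * Ln 2 else if z = 1 then 0 else Ln ((1 + z) / 2) * log_quot z / z)"

lemma convex_quarter_disc: "convex quarter_disc"
  unfolding quarter_disc_def
  by (intro convex_Int convex_cball convex_halfspace_Re_ge convex_halfspace_Im_ge)

text \<open>The Cayley transform sends the disc into the right half-plane: the numerator of the real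
  part is 1 minus the squared modulus of \<open>z\<close>.\<close>

lemma Re_one_plus_div_one_minus_nonneg:
  assumes "norm z \<le> 1" shows "Re ((1 + z) / (1 - z)) \<ge> 0"
proof -
  have "(Re z) ^ 2 + (Im z) ^ 2 \<le> 1"
    using assms by (metis cmod_power2 norm_ge_zero power_le_one)
  moreover have "0 \<le> (1 - Re z) ^ 2 + (Im z) ^ 2" by simp
  ultimately show ?thesis
    unfolding Re_divide by (intro divide_nonneg_nonneg) (auto simp: power2_eq_square algebra_simps)
qed

text \<open>Keeps \<open>log_quot\<close> off the branch cut. A nonpositive real value with
  nonnegative real part is 0, which forces \<open>z = -1\<close>, a point outside the quarter
  disc.\<close>

lemma quarter_disc_not_nonpos_Reals:
  assumes "z \<in> quarter_disc" "z \<noteq> 1" shows "(1 + z) / (1 - z) \<notin> \<real>\<^sub>\<le>\<^sub>0"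
proof
  assume "(1 + z) / (1 - z) \<in> \<real>\<^sub>\<le>\<^sub>0"
  then obtain x where x: "(1 + z) / (1 - z) = of_real x" "x \<le> 0" by (auto simp: nonpos_Reals_def)
  moreover have "x \<ge> 0"
    using Re_one_plus_div_one_minus_nonneg[of z] x assms by (auto simp: quarter_disc_def)
  ultimately have "1 + z = 0" using assms by auto
  then have "Re z = - 1" by (metis add_eq_0_iff one_complex.sel(1) uminus_complex.sel(1) equation_minus_iff)
  with assms show False by (simp add: quarter_disc_def)
qed

lemma has_field_derivative_Ln_half:
  "(1 + z) / 2 \<notin> \<real>\<^sub>\<le>\<^sub>0 \<Longrightarrow>
    ((\<lambda>z. Ln ((1 + z) / 2)) has_field_derivative inverse ((1 + z) / 2) * (1 / 2)) (at z)"
  by (intro DERIV_chain2[OF has_field_derivative_Ln]) (auto intro!: derivative_eq_intros)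

lemma contour_fn_differentiable:
  assumes "z \<in> quarter_disc" "z \<noteq> 1" "z \<noteq> 0"
  shows "contour_fn field_differentiable at z"
proof -
  have "(1 + z) / 2 \<notin> \<real>\<^sub>\<le>\<^sub>0"
    using assms by (auto simp: complex_nonpos_Reals_iff quarter_disc_def)
  then have "((\<lambda>z. Ln ((1 + z) / 2)) has_field_derivative inverse ((1 + z) / 2) * (1 / 2)) (at z)"
    by (rule has_field_derivative_Ln_half)
  moreover have "(log_quot has_field_derivative
      inverse ((1 + z) / (1 - z)) * ((1 * (1 - z) - (1 + z) * (- 1)) / ((1 - z) * (1 - z)))) (at z)"
    unfolding log_quot_def using assms quarter_disc_not_nonpos_Reals[OF assms(1,2)]
    by (intro DERIV_chain2[OF has_field_derivative_Ln] DERIV_divide) (auto intro!: derivative_eq_intros)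
  ultimately have "(\<lambda>z. Ln ((1 + z) / 2) * log_quot z / z) field_differentiable at z"
    using assms(3) by (intro field_differentiable_divide field_differentiable_mult)
      (auto simp: field_differentiable_def)
  then obtain d where "((\<lambda>z. Ln ((1 + z) / 2) * log_quot z / z) has_field_derivative d) (at z)"
    by (auto simp: field_differentiable_def)
  then have "(contour_fn has_field_derivative d) (at z)"
    by (rule has_field_derivative_transform_within_open[where S = "- {0, 1}"])
       (use assms in \<open>auto simp: contour_fn_def open_Compl finite_imp_closed\<close>)
  then show ?thesis by (auto simp: field_differentiable_def)
qed

text \<open>The quotient \<open>log_quot z / z\<close> tends to the derivative 2 of
  \<open>log_quot\<close> at 0, and the other factor tends to
  \<open>Ln (1 / 2) = - Ln 2\<close>.\<close>

lemma isCont_contour_fn_0: "isCont contour_fn 0"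
proof -
  have "(log_quot has_field_derivative 2) (at 0)"
    unfolding log_quot_def by (auto intro!: derivative_eq_intros)
  then have "((\<lambda>z. log_quot z / z) \<longlongrightarrow> 2) (at 0)"
    by (simp add: has_field_derivative_iff log_quot_def)
  moreover have "isCont (\<lambda>z. Ln ((1 + z) / 2)) 0"
    by (intro continuous_intros) (auto simp: complex_nonpos_Reals_iff)
  then have "((\<lambda>z. Ln ((1 + z) / 2)) \<longlongrightarrow> Ln (1 / 2)) (at 0)"
    by (simp add: isCont_def)
  ultimately have "((\<lambda>z. Ln ((1 + z) / 2) * (log_quot z / z)) \<longlongrightarrow> Ln (1 / 2) * 2) (at 0)"
    by (intro tendsto_mult)
  moreover have "Ln (1 / 2 :: complex) = - Ln 2"
    using Ln_inverse[of "2 :: complex"] by (simp add: inverse_eq_divide complex_nonpos_Reals_iff)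
  ultimately have "((\<lambda>z. Ln ((1 + z) / 2) * (log_quot z / z)) \<longlongrightarrow> contour_fn 0) (at 0)"
    by (simp add: contour_fn_def mult.commute)
  moreover have "\<forall>\<^sub>F z in at 0. Ln ((1 + z) / 2) * (log_quot z / z) = contour_fn z"
    using eventually_at_in_open'[of "- {1::complex}" 0] eventually_neq_at_within[of 0]
    by (auto simp: contour_fn_def  eventually_conj_iff elim!: eventually_elim2)
  ultimately show ?thesis
    unfolding isCont_def by (rule Lim_transform_eventually)
qed

text \<open>The first logarithm has a zero at 1, so it stays bounded after division by
  \<open>z - 1\<close>; the spare factor \<open>z - 1\<close> beats the logarithmic growth of
  \<open>log_quot\<close>.\<close>

lemma tendsto_contour_fn_1: "(contour_fn \<longlongrightarrow> contour_fn 1) (at 1 within quarter_disc)"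
proof -
  have "((\<lambda>z. Ln ((1 + z) / 2)) has_field_derivative 1 / 2) (at 1)"
    using has_field_derivative_Ln_half[of 1] by simp
  then have "((\<lambda>z. Ln ((1 + z) / 2) / (z - 1)) \<longlongrightarrow> 1 / 2) (at 1 within quarter_disc)"
    by (auto simp: has_field_derivative_iff intro: tendsto_within_subset[of _ _ 1 UNIV])
  moreover have "((\<lambda>z. (z - 1) * log_quot z) \<longlongrightarrow> 0) (at 1 within quarter_disc)"
  proof (rule Lim_null_comparison)
    have "filterlim (\<lambda>z. norm (z - 1)) (at_right 0) (at (1::complex) within quarter_disc)"
      unfolding filterlim_at by (auto intro!: tendsto_eq_intros simp: eventually_at_filter)
    moreover have "((\<lambda>r. r * (\<bar>ln r\<bar> + ln 2 + pi)) \<longlongrightarrow> 0) (at_right 0)"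
      by real_asymp
    ultimately show "((\<lambda>z. norm (z - 1) * (\<bar>ln (norm (z - 1))\<bar> + ln 2 + pi)) \<longlongrightarrow> 0) (at 1 within quarter_disc)"
      by (rule filterlim_compose[rotated])
    show "\<forall>\<^sub>F z in at 1 within quarter_disc. norm ((z - 1) * log_quot z) \<le> norm (z - 1) * (\<bar>ln (norm (z - 1))\<bar> + ln 2 + pi)"
      unfolding eventually_at_filter
    proof (intro always_eventually allI impI)
      fix z assume z: "z \<noteq> 1" "z \<in> quarter_disc"
      then have nz: "(1 + z) / (1 - z) \<noteq> 0" using quarter_disc_not_nonpos_Reals[OF z(2,1)] by auto
      \<comment> \<open>With the modulus of \<open>1 + z\<close> between 1 and 2 and the argument
        bounded by \<open>pi\<close>, only \<open>ln (norm (z - 1))\<close> is unbounded.\<close>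
      have "norm (1 + z) \<ge> 1"
      proof -
        have "1 \<le> Re (1 + z)" using z by (simp add: quarter_disc_def)
        then show ?thesis using complex_Re_le_cmod order_trans by blast
      qed
      moreover have "norm (1 + z) \<le> 2"
        using norm_triangle_ineq[of 1 z] z by (simp add: quarter_disc_def)
      ultimately have "\<bar>ln (norm (1 + z))\<bar> \<le> ln 2"
        using ln_ge_zero[of "norm (1 + z)"] ln_le_cancel_iff[of "norm (1 + z)" 2] by linarith
      moreover have "Re (log_quot z) = ln (norm (1 + z)) - ln (norm (z - 1))"
        using nz z unfolding log_quot_def by (simp add: norm_divide ln_div norm_minus_commute)
      moreover have "\<bar>Im (log_quot z)\<bar> \<le> pi"
        using mpi_less_Im_Ln[OF nz] Im_Ln_le_pi[OF nz] by (simp add: log_quot_def abs_le_iff)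
      ultimately have "norm (log_quot z) \<le> \<bar>ln (norm (z - 1))\<bar> + ln 2 + pi"
        using cmod_le[of "log_quot z"] by linarith
      then show "norm ((z - 1) * log_quot z) \<le> norm (z - 1) * (\<bar>ln (norm (z - 1))\<bar> + ln 2 + pi)"
        by (simp add: norm_mult mult_left_mono)
    qed
  qed
  ultimately have "((\<lambda>z. Ln ((1 + z) / 2) / (z - 1) * ((z - 1) * log_quot z)) \<longlongrightarrow> 1 / 2 * 0) (at 1 within quarter_disc)"
    by (rule tendsto_mult)
  then have "((\<lambda>z. Ln ((1 + z) / 2) / (z - 1) * ((z - 1) * log_quot z) / z) \<longlongrightarrow> 1 / 2 * 0 / 1) (at 1 within quarter_disc)"
    by (rule tendsto_divide[OF _ tendsto_ident_at]) simp
  then have "((\<lambda>z. Ln ((1 + z) / 2) / (z - 1) * ((z - 1) * log_quot z) / z) \<longlongrightarrow> contour_fn 1) (at 1 within quarter_disc)"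
    by (simp add: contour_fn_def)
  then show ?thesis
  proof (rule Lim_transform_eventually)
    have "\<forall>\<^sub>F z in at 1 within quarter_disc. z \<noteq> 0"
      by (rule tendsto_imp_eventually_ne[OF tendsto_ident_at]) auto
    moreover have "\<forall>\<^sub>F z in at 1 within quarter_disc. z \<noteq> 1"
      by (auto simp: eventually_at_filter)
    ultimately show "\<forall>\<^sub>F z in at 1 within quarter_disc. Ln ((1 + z) / 2) / (z - 1) * ((z - 1) * log_quot z) / z = contour_fn z"
      by eventually_elim (simp add: contour_fn_def)
  qed
qed

lemma continuous_on_contour_fn: "continuous_on quarter_disc contour_fn"
  unfolding continuous_on_eq_continuous_within
proof
  fix z assume "z \<in> quarter_disc"
  consider "z = 0" | "z = 1" | "z \<noteq> 0" "z \<noteq> 1" by blast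
  then show "continuous (at z within quarter_disc) contour_fn"
  proof cases
    case 1 then show ?thesis using isCont_contour_fn_0 continuous_at_imp_continuous_at_within by blast
  next
    case 2 then show ?thesis using tendsto_contour_fn_1 by (simp add: continuous_within)
  next
    case 3 then show ?thesis
      using contour_fn_differentiable[OF \<open>z \<in> quarter_disc\<close>] field_differentiable_imp_continuous_at continuous_at_imp_continuous_at_within by blast
  qed
qed

lemma one_plus_i_times_real_nonzero: "1 - \<i> * of_real t \<noteq> 0" "1 + \<i> * of_real t \<noteq> 0"
  by (auto simp: complex_eq_iff)

lemma Ln_one_plus_i_times_real:
  "Ln (1 + \<i> * of_real t) = Complex (ln (1 + t ^ 2) / 2) (arctan t)"
  using one_plus_i_times_real_nonzero[of t]
  by (auto simp: complex_eq_iff Im_Ln_eq cmod_def ln_sqrt add_pos_nonneg)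

lemma Ln_one_minus_i_times_real:
  "Ln (1 - \<i> * of_real t) = Complex (ln (1 + t ^ 2) / 2) (- arctan t)"
  using Ln_one_plus_i_times_real[of "- t"] by (simp add: arctan_minus)

text \<open>Both logarithms are real here, so the real segment drops out once imaginary parts are
  taken.\<close>

lemma Im_contour_fn_real:
  assumes t: "0 < t" "t < 1"
  shows "Im (1 * contour_fn (of_real t)) = 0"
proof -
  have "contour_fn (of_real t) \<in> \<real>"
  proof -
    have "Ln ((1 + of_real t) / 2) = of_real (ln ((1 + t) / 2))"
      using Ln_of_real[of "(1 + t) / 2"] t by simp
    moreover have "log_quot (of_real t) = of_real (ln ((1 + t) / (1 - t)))"
      using Ln_of_real[of "(1 + t) / (1 - t)"] t by (simp add: log_quot_def)
    ultimately show ?thesis using t by (simp add: contour_fn_def)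
  qed
  then show ?thesis by (simp add: complex_is_Real_iff)
qed

lemma Im_contour_fn_imag:
  assumes t: "0 < t" "t < 1"
  shows "Im (\<i> * contour_fn (\<i> * of_real t)) = arctan t * (ln (1 + t ^ 2) - 2 * ln 2) / t"
proof -
  note nz = one_plus_i_times_real_nonzero and Ln_plus = Ln_one_plus_i_times_real
  have "log_quot (\<i> * of_real t) = 2 * \<i> * of_real (arctan t)"
  proof -
    \<comment> \<open>\<open>Arctan\<close> is defined by this very logarithm, taken at
      \<open>- t\<close>.\<close>
    have "\<i> * log_quot (\<i> * of_real t) = - (2 * of_real (arctan t))"
      using Arctan_of_real[of "- t"] by (simp add: Arctan_def log_quot_def arctan_minus field_simps)
    then have "- \<i> * (\<i> * log_quot (\<i> * of_real t)) = 2 * \<i> * of_real (arctan t)"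
      by simp
    then show ?thesis by simp
  qed
  moreover have "Ln ((1 + \<i> * of_real t) / 2) = Ln (1 + \<i> * of_real t) - of_real (ln 2)"
    using Ln_divide_of_real[of 2 "1 + \<i> * of_real t"] nz[of t] by simp
  ultimately have "\<i> * contour_fn (\<i> * of_real t) = Complex (ln (1 + t ^ 2) / 2 - ln 2) (arctan t) * (2 * \<i> * of_real (arctan t)) / of_real t"
    using t by (simp add: contour_fn_def  Ln_plus complex_eq_iff)
  then show ?thesis
    using t by (simp only: Im_divide_of_real) (simp add: field_simps)
qed

text \<open>On the parametrized arc, \<open>(1 + z) / 2\<close> is the inverse of
  \<open>1 - \<i> * t\<close>, the argument of \<open>log_quot\<close> is \<open>\<i> / t\<close>,
  and dz/z becomes \<open>2 * \<i> / (1 + t ^ 2)\<close> dt.\<close>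

lemma Im_contour_fn_arc:
  assumes t: "0 < t" "t < 1"
  shows "Im ((2 * \<i> / (1 - \<i> * of_real t) ^ 2) * contour_fn ((1 + \<i> * of_real t) / (1 - \<i> * of_real t)))
    = ln t * ln (1 + t ^ 2) / (1 + t ^ 2) - pi * arctan t / (1 + t ^ 2)"
proof -
  let ?\<gamma> = "\<lambda>t. (1 + \<i> * of_real t) / (1 - \<i> * of_real t)"
  note nz = one_plus_i_times_real_nonzero and Ln_minus = Ln_one_minus_i_times_real
  have "?\<gamma> t \<noteq> 1" "?\<gamma> t \<noteq> 0" using nz[of t] t by auto
  then have "contour_fn (?\<gamma> t) = Ln ((1 + ?\<gamma> t) / 2) * log_quot (?\<gamma> t) / ?\<gamma> t" by (simp add: contour_fn_def)
  moreover have "(1 + ?\<gamma> t) / 2 = inverse (1 - \<i> * of_real t)"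
    using nz[of t] by (simp add: field_simps)
  then have "Ln ((1 + ?\<gamma> t) / 2) = - Ln (1 - \<i> * of_real t)"
    by (simp add: Ln_inverse complex_nonpos_Reals_iff)
  moreover have "(1 + ?\<gamma> t) / (1 - ?\<gamma> t) = of_real (1 / t) * \<i>"
  proof -
    have "1 + ?\<gamma> t = 2 / (1 - \<i> * of_real t)" "1 - ?\<gamma> t = - (2 * \<i> * of_real t) / (1 - \<i> * of_real t)"
      using nz[of t] by (auto simp: add_divide_eq_iff diff_divide_eq_iff divide_diff_eq_iff)
    moreover have "(2 / w) / (- v / w) = 2 / (- v)" if "w \<noteq> 0" for v w :: complex
      using that by simp
    ultimately have "(1 + ?\<gamma> t) / (1 - ?\<gamma> t) = 2 / (- (2 * \<i> * of_real t))"
      using nz(1)[of t] by presburger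
    also have "\<dots> = of_real (1 / t) * \<i>" using t by (simp add: field_simps)
    finally show ?thesis .
  qed
  then have "log_quot (?\<gamma> t) = Complex (- ln t) (pi / 2)"
  proof -
    assume "(1 + ?\<gamma> t) / (1 - ?\<gamma> t) = of_real (1 / t) * \<i>"
    then have "log_quot (?\<gamma> t) = Ln (of_real (1 / t) * \<i>)"
      by (simp only: log_quot_def)
    also have "\<dots> = of_real (ln (1 / t)) + Ln \<i>"
      using Ln_times_of_real[of "1 / t" \<i>] Ln_of_real[of "1 / t"] t by (simp del: of_real_divide)
    also have "ln (1 / t) = - ln t"
      using t by (simp add: ln_div)
    finally show ?thesis
      by (simp add: complex_eq_iff)
  qed
  ultimately have "contour_fn (?\<gamma> t) = - Complex (ln (1 + t ^ 2) / 2) (- arctan t) * Complex (- ln t) (pi / 2) / ?\<gamma> t"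
    by (simp add:  Ln_minus)
  moreover have "2 * \<i> / (1 - \<i> * of_real t) ^ 2 * (w / ?\<gamma> t) = 2 * \<i> * w / of_real (1 + t ^ 2)" for w
  proof -
    have "(1 - \<i> * of_real t) * (1 + \<i> * of_real t) = of_real (1 + t ^ 2)"
      by (simp add: algebra_simps power2_eq_square)
    moreover have "2 * \<i> / a ^ 2 * (w / (b / a)) = 2 * \<i> * w / (a * b)" if "a \<noteq> 0" "b \<noteq> 0" for a b :: complex
      using that by (simp add: power2_eq_square)
    ultimately show ?thesis using nz[of t] by metis
  qed
  ultimately have "(2 * \<i> / (1 - \<i> * of_real t) ^ 2) * contour_fn (?\<gamma> t)
      = 2 * \<i> * (- Complex (ln (1 + t ^ 2) / 2) (- arctan t) * Complex (- ln t) (pi / 2)) / of_real (1 + t ^ 2)"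
    by presburger
  then show ?thesis
    by (simp add: Im_divide_of_real diff_divide_distrib mult.commute[of "ln t"] mult.commute[of pi "arctan t"])
qed

text \<open>On the convex domain, continuity together with differentiability in the interior off 0
  and 1 yields a primitive \<open>F\<close>. Its values at 0, 1 and \<open>\<i>\<close> cancel
  around the boundary, and the imaginary part of that identity is the claim.\<close>

lemma integral_contour_fn_boundary:
  "((\<lambda>t. arctan t * (ln (1 + t ^ 2) - 2 * ln 2) / t - ln t * ln (1 + t ^ 2) / (1 + t ^ 2)
     + pi * arctan t / (1 + t ^ 2)) has_integral 0) {0..1}"
proof -
  obtain F where F: "\<And>z. z \<in> quarter_disc \<Longrightarrow> (F has_field_derivative contour_fn z) (at z within quarter_disc)"
  proof (rule holomorphic_convex_primitive[OF convex_quarter_disc _ continuous_on_contour_fn, of "{0, 1}"])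
    show "contour_fn field_differentiable at z" if "z \<in> interior quarter_disc - {0, 1}" for z
      using that interior_subset[of quarter_disc] by (intro contour_fn_differentiable) auto
  qed auto
  have FTC: "((\<lambda>t. \<gamma>' t * contour_fn (\<gamma> t)) has_integral F (\<gamma> 1) - F (\<gamma> 0)) {0..1}"
    if "\<And>t. t \<in> {0..1} \<Longrightarrow> \<gamma> t \<in> quarter_disc"
      and \<gamma>: "\<And>t. t \<in> {0..1} \<Longrightarrow> (\<gamma> has_vector_derivative \<gamma>' t) (at t within {0..1})" for \<gamma> \<gamma>'
  proof (rule fundamental_theorem_of_calculus)
    fix t :: real assume t: "t \<in> {0..1}"
    have "(F has_field_derivative contour_fn (\<gamma> t)) (at (\<gamma> t) within \<gamma> ` {0..1})"
      by (rule DERIV_subset[OF F]) (use t that in auto)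
    from field_vector_diff_chain_within[OF \<gamma>[OF t] this]
    show "((\<lambda>t. F (\<gamma> t)) has_vector_derivative \<gamma>' t * contour_fn (\<gamma> t)) (at t within {0..1})"
      by (simp add: o_def)
  qed auto
  have real_segment: "((\<lambda>t. 1 * contour_fn (of_real t)) has_integral F (of_real 1) - F (of_real 0)) {0..1}"
    by (rule FTC) (auto simp: quarter_disc_def intro!: derivative_eq_intros)
  have imag_segment: "((\<lambda>t. \<i> * contour_fn (\<i> * of_real t)) has_integral F (\<i> * of_real 1) - F (\<i> * of_real 0)) {0..1}"
    by (rule FTC) (auto simp: quarter_disc_def norm_mult intro!: derivative_eq_intros)
  let ?\<gamma> = "\<lambda>t. (1 + \<i> * of_real t) / (1 - \<i> * of_real t)"
    \<comment> \<open>the substitution \<open>t = tan (\<theta> / 2)\<close> turns the logarithms on the arc into \<open>ln t\<close> and \<open>Ln (1 - \<i> t)\<close>\<close>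
  note nz = one_plus_i_times_real_nonzero
  have arc: "((\<lambda>t. (2 * \<i> / (1 - \<i> * of_real t) ^ 2) * contour_fn (?\<gamma> t)) has_integral F (?\<gamma> 1) - F (?\<gamma> 0)) {0..1}"
  proof (rule FTC)
    fix t :: real assume t: "t \<in> {0..1}"
    have "norm (1 + \<i> * of_real t) = norm (1 - \<i> * of_real t)"
      by (simp add: cmod_def)
    then have "norm (?\<gamma> t) = 1" using nz[of t] by (simp add: norm_divide)
    moreover have "t * t \<le> 1" using t by (simp add: mult_le_one)
    then have "Re (?\<gamma> t) \<ge> 0" by (simp add: Re_divide)
    moreover have "Im (?\<gamma> t) \<ge> 0" using t by (simp add: Im_divide)
    ultimately show "?\<gamma> t \<in> quarter_disc" by (simp add: quarter_disc_def)
    have "((\<lambda>z. (1 + \<i> * z) / (1 - \<i> * z)) has_field_derivative 2 * \<i> / (1 - \<i> * of_real t) ^ 2) (at (of_real t))"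
      using nz[of t] by (auto intro!: derivative_eq_intros simp: field_simps power2_eq_square)
    then show "(?\<gamma> has_vector_derivative 2 * \<i> / (1 - \<i> * of_real t) ^ 2) (at t within {0..1})"
      by (rule has_vector_derivative_real_field[THEN has_vector_derivative_at_within])
  qed
  \<comment> \<open>The arc runs from 1 to \<open>\<i>\<close>, so the real segment followed by it
    has the same endpoints as the imaginary segment.\<close>
  have "?\<gamma> 1 = \<i>" by (simp add: complex_eq_iff Re_divide Im_divide)
  then have "((\<lambda>t. \<i> * contour_fn (\<i> * of_real t) - 1 * contour_fn (of_real t) - (2 * \<i> / (1 - \<i> * of_real t) ^ 2) * contour_fn (?\<gamma> t))
      has_integral 0) {0..1}"
    using has_integral_diff[OF has_integral_diff[OF imag_segment real_segment] arc] by simp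
  then have "((Im \<circ> (\<lambda>t. \<i> * contour_fn (\<i> * of_real t) - 1 * contour_fn (of_real t) - (2 * \<i> / (1 - \<i> * of_real t) ^ 2) * contour_fn (?\<gamma> t)))
      has_integral Im 0) {0..1}"
    by (rule has_integral_linear[OF _ bounded_linear_Im])
  then show ?thesis
    unfolding zero_complex.sel
  proof (rule has_integral_spike_finite[rotated 2])
    fix t :: real assume "t \<in> {0..1} - {0, 1}"
    then have t: "0 < t" "t < 1" by auto
    show "arctan t * (ln (1 + t ^ 2) - 2 * ln 2) / t - ln t * ln (1 + t ^ 2) / (1 + t ^ 2)
       + pi * arctan t / (1 + t ^ 2)
      = (Im \<circ> (\<lambda>t. \<i> * contour_fn (\<i> * of_real t) - 1 * contour_fn (of_real t) - (2 * \<i> / (1 - \<i> * of_real t) ^ 2) * contour_fn (?\<gamma> t))) t"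
      unfolding o_def minus_complex.sel Im_contour_fn_real[OF t] Im_contour_fn_imag[OF t] Im_contour_fn_arc[OF t] by simp
  qed auto
qed

subsection \<open>The inverse tangent integral\<close>

text \<open>The odd series of \<open>Ti\<close> is handled as \<open>x\<close> times a series in
  \<open>x ^ 2\<close>, the shape to which the power series lemmas apply.\<close>

definition atan_coeff :: "nat \<Rightarrow> real" where
  "atan_coeff k = (- 1) ^ k / (2 * real k + 1) ^ 2"

definition atan_gen :: "real \<Rightarrow> real" where
  "atan_gen x = (\<Sum>k. atan_coeff k * x ^ k)"

text \<open>The inverse tangent integral, conventionally \<open>Ti\<^sub>2\<close>.\<close>

definition Ti :: "real \<Rightarrow> real" where
  "Ti x = x * atan_gen (x ^ 2)"

lemma summable_abs_atan_coeff: "summable (\<lambda>k. \<bar>atan_coeff k\<bar>)"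
proof (rule summable_comparison_test')
  show "summable (\<lambda>k. inverse (real (Suc k)) ^ 2)"
    using summable_Suc_iff[of "\<lambda>k. inverse (real k) ^ 2"] inverse_power_summable[of 2, where 'a=real] by (simp add: power_inverse)
  show "norm \<bar>atan_coeff k\<bar> \<le> inverse (real (Suc k)) ^ 2" for k
    by (simp add: atan_coeff_def abs_mult power_abs divide_inverse power_inverse)
qed

lemmas atan_gen_sums = abs_summable_powser_sums[OF summable_abs_atan_coeff atan_gen_def]

lemma atan_gen_sq_continuous: "continuous_on {0..1} (\<lambda>x. atan_gen (x ^ 2))"
  by (rule continuous_on_compose2[OF abs_summable_powser_continuous[OF summable_abs_atan_coeff atan_gen_def]])
     (auto intro!: continuous_intros simp: power_le_one order_trans[of "-1" 0])

lemma Ti_continuous: "continuous_on {0..1} Ti"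
  unfolding Ti_def by (intro continuous_intros atan_gen_sq_continuous)

lemma Ti_tendsto_0: "(Ti \<longlongrightarrow> 0) (at_right 0)"
  using continuous_on_Icc_at_rightD[OF Ti_continuous] by (simp add: Ti_def)

lemma Ti_tendsto_1: "(Ti \<longlongrightarrow> Ti 1) (at_left 1)"
  using continuous_on_Icc_at_leftD[OF Ti_continuous] by simp

text \<open>Writing \<open>k\<close> as half of \<open>(2 * k + 1) - 1\<close> splits
  \<open>k * atan_coeff k\<close> into half the coefficient of \<open>arctan x / x\<close> minus
  half of \<open>atan_coeff k\<close>; the \<open>atan_gen\<close> parts cancel in the product
  rule.\<close>

lemma Ti_deriv:
  assumes "0 < x" "x < 1"
  shows "(Ti has_real_derivative arctan x / x) (at x)"
proof -
  have x2: "0 < x ^ 2" "x ^ 2 < 1" using assms by (auto simp: power_less_one_iff)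
  have "(\<lambda>k. (- 1) ^ k * (1 / real (k * 2 + 1) * x ^ (k * 2 + 1))) sums arctan x"
    using arctan_series[of x] summable_arctan_series[of x] assms by (simp add: sums_iff)
  then have "(\<lambda>k. ((- 1) ^ k * (1 / real (k * 2 + 1) * x ^ (k * 2 + 1)) / x - atan_coeff k * (x ^ 2) ^ k) / 2)
      sums ((arctan x / x - atan_gen (x ^ 2)) / 2)"
    using assms x2 by (intro sums_divide sums_diff atan_gen_sums) auto
  moreover have "((- 1) ^ k * (1 / real (k * 2 + 1) * x ^ (k * 2 + 1)) / x - atan_coeff k * (x ^ 2) ^ k) / 2
      = real k * atan_coeff k * (x ^ 2) ^ k" for k
  proof -
    have "(- 1) ^ k * (1 / real (k * 2 + 1) * x ^ (k * 2 + 1)) / x = (2 * real k + 1) * atan_coeff k * (x ^ 2) ^ k"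
    proof -
      have "x ^ (k * 2 + 1) / x = (x ^ 2) ^ k"
        using assms by (simp add: mult.commute flip: power_mult)
      then have "(- 1) ^ k * (1 / real (k * 2 + 1) * x ^ (k * 2 + 1)) / x = (- 1) ^ k / (2 * real k + 1) * (x ^ 2) ^ k"
        using assms by (simp add: mult.commute add.commute)
      then show ?thesis by (simp add: atan_coeff_def power2_eq_square[of "2 * real k + 1"])
    qed
    then show ?thesis by (simp add: algebra_simps)
  qed
  ultimately have s: "(\<lambda>k. real k * atan_coeff k * (x ^ 2) ^ k) sums ((arctan x / x - atan_gen (x ^ 2)) / 2)"
    by simp
  have d: "(atan_gen has_real_derivative (arctan x / x - atan_gen (x ^ 2)) / 2 / x ^ 2) (at (x ^ 2))"
    using abs_summable_powser_deriv[OF summable_abs_atan_coeff atan_gen_def _ _ s] x2 by simp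
  have "((\<lambda>x. atan_gen (x ^ 2)) has_real_derivative
      (arctan x / x - atan_gen (x ^ 2)) / 2 / x ^ 2 * (2 * x)) (at x)"
    by (rule DERIV_chain2[of atan_gen _ "\<lambda>x. x ^ 2", OF d]) (auto intro!: derivative_eq_intros)
  then have "(Ti has_real_derivative 1 * atan_gen (x ^ 2) +
      (arctan x / x - atan_gen (x ^ 2)) / 2 / x ^ 2 * (2 * x) * x) (at x)"
    unfolding Ti_def by (intro DERIV_mult DERIV_ident)
  then show ?thesis
    by (rule DERIV_cong) (use assms in \<open>simp add: power2_eq_square\<close>)
qed

text \<open>Integrating \<open>x ^ (2 * k)\<close> contributes one more factor
  \<open>2 * k + 1\<close>, turning squares into the alternating odd cubes.\<close>

lemma integral_Ti_div: "((\<lambda>x. Ti x / x) has_integral pi ^ 3 / 32) {0..1}"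
proof -
  have "(\<lambda>k. atan_coeff k * integral {0..1} (\<lambda>x. 1 * x ^ (2 * k))) sums
      integral {0..1} (\<lambda>x. 1 * atan_gen (x ^ 2))"
    by (intro abs_summable_powser_integral[OF summable_abs_atan_coeff atan_gen_def] continuous_intros)
  moreover have "integral {0..1} (\<lambda>x::real. 1 * x ^ (2 * k)) = 1 / (2 * real k + 1)" for k
    using integral_unique[OF has_integral_power_01[of "2 * k"]] by simp
  moreover have "atan_coeff k * (1 / (2 * real k + 1)) = (- 1) ^ k / (2 * real k + 1) ^ 3" for k
    by (simp add: atan_coeff_def power2_eq_square power3_eq_cube)
  ultimately have "integral {0..1} (\<lambda>x. atan_gen (x ^ 2)) = pi ^ 3 / 32"
    using alternating_odd_cubes_sums sums_unique2 by force
  then have "((\<lambda>x. atan_gen (x ^ 2)) has_integral pi ^ 3 / 32) {0..1}"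
    using integrable_integral[OF integrable_continuous_real[OF atan_gen_sq_continuous]] by metis
  then show ?thesis
    by (rule has_integral_spike_finite[of "{0}", rotated 2]) (auto simp: Ti_def)
qed

text \<open>Integration by parts with the antiderivative \<open>Ti\<close> of
  \<open>arctan x / x\<close>; both boundary terms vanish.\<close>

lemma integral_ln_arctan_div: "((\<lambda>x. ln x * arctan x / x) has_integral - (pi ^ 3 / 32)) {0..1}"
proof -
  have "((\<lambda>x. ln x * arctan x / x + Ti x / x) has_integral 0 - 0) {0..1}"
  proof (rule fundamental_theorem_of_calculus_limits)
    show "((\<lambda>x. ln x * Ti x) has_real_derivative ln x * arctan x / x + Ti x / x) (at x)" if "0 < x" "x < 1" for x
      using that by (auto intro!: derivative_eq_intros Ti_deriv)
    have "((\<lambda>x. (x * ln x) * atan_gen (x ^ 2)) \<longlongrightarrow> 0 * atan_gen (0 ^ 2)) (at_right 0)"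
    proof (intro tendsto_mult)
      show "((\<lambda>x::real. x * ln x) \<longlongrightarrow> 0) (at_right 0)" by real_asymp
      show "((\<lambda>x. atan_gen (x ^ 2)) \<longlongrightarrow> atan_gen (0 ^ 2)) (at_right 0)"
        using continuous_on_Icc_at_rightD[OF atan_gen_sq_continuous] by simp
    qed
    then show "((\<lambda>x. ln x * Ti x) \<longlongrightarrow> 0) (at_right 0)" by (simp add: Ti_def mult_ac)
    have "((\<lambda>x. ln x * Ti x) \<longlongrightarrow> ln 1 * Ti 1) (at_left 1)"
      by (intro tendsto_intros Ti_tendsto_1) auto
    then show "((\<lambda>x. ln x * Ti x) \<longlongrightarrow> 0) (at_left 1)" by simp
  qed auto
  from has_integral_diff[OF this integral_Ti_div] show ?thesis by simp
qed

text \<open>Existence of the second iterated integral is a conclusion: nonnegativity lets both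
  orders be compared as extended nonnegative integrals, and finiteness of \<open>I\<close> makes
  \<open>G\<close> integrable. The inner integrals are required only on open intervals, because the
  kernels may be singular at the boundary.\<close>

lemma has_integral_Tonelli:
  fixes f :: "real \<Rightarrow> real \<Rightarrow> real"
  assumes f: "(\<lambda>(x, y). f x y) \<in> borel_measurable borel" and G: "G \<in> borel_measurable borel"
    and nonneg: "\<And>x y. x \<in> {a<..<b} \<Longrightarrow> y \<in> {c<..<d} \<Longrightarrow> 0 \<le> f x y"
    and inner: "\<And>x. x \<in> {a<..<b} \<Longrightarrow> (f x has_integral F x) {c..d}"
    and inner': "\<And>y. y \<in> {c<..<d} \<Longrightarrow> ((\<lambda>x. f x y) has_integral G y) {a..b}"
    and outer: "(F has_integral I) {a..b}"
  shows "(G has_integral I) {c..d}"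
proof -
  let ?A = "{a<..<b}" and ?B = "{c<..<d}"
  have F_nonneg: "F x \<ge> 0" if "x \<in> ?A" for x
    using inner[OF that] nonneg[OF that] unfolding has_integral_Icc_iff_Ioo by (rule has_integral_nonneg)
  have G_nonneg: "G y \<ge> 0" if "y \<in> ?B" for y
    using inner'[OF that] nonneg[OF _ that] unfolding has_integral_Icc_iff_Ioo by (rule has_integral_nonneg)
  have I_nonneg: "I \<ge> 0"
    using outer F_nonneg unfolding has_integral_Icc_iff_Ioo by (rule has_integral_nonneg)
  have f': "(\<lambda>(x, y). f x y) \<in> borel_measurable (lborel \<Otimes>\<^sub>M lborel)"
    using f by (simp add: lborel_prod)
  have "ennreal I = (\<integral>\<^sup>+x. ennreal (F x) * indicator ?A x \<partial>lborel)"
    by (rule nn_integral_has_integral_lebesgue'[symmetric])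
       (use outer F_nonneg in \<open>auto simp: has_integral_Icc_iff_Ioo\<close>)
  also have "\<dots> = (\<integral>\<^sup>+x. \<integral>\<^sup>+y. ennreal (f x y) * indicator ?B y * indicator ?A x \<partial>lborel \<partial>lborel)"
  proof (rule nn_integral_cong)
    fix x
    show "ennreal (F x) * indicator ?A x = (\<integral>\<^sup>+y. ennreal (f x y) * indicator ?B y * indicator ?A x \<partial>lborel)"
    proof (cases "x \<in> ?A")
      case True
      then have "(\<integral>\<^sup>+y. ennreal (f x y) * indicator ?B y \<partial>lborel) = ennreal (F x)"
        by (intro nn_integral_has_integral_lebesgue')
           (use inner nonneg in \<open>auto simp: has_integral_Icc_iff_Ioo\<close>)
      then show ?thesis using True by simp
    qed simp
  qed
  also have "\<dots> = (\<integral>\<^sup>+y. \<integral>\<^sup>+x. ennreal (f x y) * indicator ?B y * indicator ?A x \<partial>lborel \<partial>lborel)"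
  proof (rule lborel_pair.Fubini'[symmetric])
    have "(\<lambda>p. ennreal (case p of (x, y) \<Rightarrow> f x y) * indicator ?B (snd p) * indicator ?A (fst p))
        \<in> borel_measurable (lborel \<Otimes>\<^sub>M lborel)"
      using f' by measurable
    then show "(\<lambda>(x, y). ennreal (f x y) * indicator ?B y * indicator ?A x) \<in> borel_measurable (lborel \<Otimes>\<^sub>M lborel)"
      by (simp add: case_prod_beta')
  qed
  also have "\<dots> = (\<integral>\<^sup>+y. ennreal (indicator ?B y * G y) \<partial>lborel)"
  proof (rule nn_integral_cong)
    fix y
    show "(\<integral>\<^sup>+x. ennreal (f x y) * indicator ?B y * indicator ?A x \<partial>lborel) = ennreal (indicator ?B y * G y)"
    proof (cases "y \<in> ?B")
      case True
      then have "(\<integral>\<^sup>+x. ennreal (f x y) * indicator ?A x \<partial>lborel) = ennreal (G y)"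
        by (intro nn_integral_has_integral_lebesgue')
           (use inner' nonneg in \<open>auto simp: has_integral_Icc_iff_Ioo\<close>)
      then show ?thesis using True by simp
    qed simp
  qed
  finally have "((\<lambda>y. indicator ?B y * G y) has_integral I) UNIV"
    using G I_nonneg G_nonneg by (intro nn_integral_has_integral) (auto simp: indicator_def)
  moreover have "(\<lambda>y. indicator ?B y * G y) = (\<lambda>y. if y \<in> ?B then G y else 0)"
    by auto
  ultimately have "(G has_integral I) ?B"
    by (simp only: has_integral_restrict_UNIV)
  then show ?thesis by (simp add: has_integral_Icc_iff_Ioo)
qed

subsection \<open>Evaluation of the logarithmic integral\<close>

lemma arctan_le_self:
  fixes x :: real
  assumes "0 \<le> x" shows "arctan x \<le> x"
proof -
  have "0 - arctan 0 \<le> x - arctan x"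
  proof (rule DERIV_nonneg_imp_nondecreasing[OF assms])
    fix t :: real
    have "((\<lambda>x. x - arctan x) has_real_derivative 1 - inverse (1 + t ^ 2)) (at t)"
      by (auto intro!: derivative_eq_intros)
    moreover have "1 - inverse (1 + t ^ 2) \<ge> 0"
      by (simp add: inverse_le_1_iff)
    ultimately show "\<exists>y. ((\<lambda>x. x - arctan x) has_real_derivative y) (at t) \<and> 0 \<le> y"
      by blast
  qed
  then show ?thesis by simp
qed

text \<open>The difference is the integral of \<open>arctan t / t\<close>, which lies between 0 and
  1. Linear decay at 1 is what tames \<open>ln (1 - x ^ 2)\<close> later.\<close>

lemma Ti_diff_bounds:
  assumes "0 < x" "x \<le> 1"
  shows "0 \<le> Ti 1 - Ti x" "Ti 1 - Ti x \<le> 1 - x"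
proof -
  have *: "((\<lambda>t. arctan t / t) has_integral Ti 1 - Ti x) {x..1}"
  proof (rule fundamental_theorem_of_calculus_interior)
    show "continuous_on {x..1} Ti"
      using Ti_continuous by (rule continuous_on_subset) (use assms in auto)
    show "(Ti has_vector_derivative arctan t / t) (at t)" if "t \<in> {x<..<1}" for t
      using Ti_deriv[of t] that assms by (simp add: has_real_derivative_iff_has_vector_derivative)
  qed (use assms in auto)
  show "0 \<le> Ti 1 - Ti x"
    using * by (rule has_integral_nonneg) (use assms in auto)
  have "((\<lambda>t::real. 1) has_integral 1 * (1 - x)) {x..1}"
    using has_integral_const_real[of "1::real" x 1] assms by simp
  then show "Ti 1 - Ti x \<le> 1 - x"
    using has_integral_le[OF *, of "\<lambda>_. 1" "1 - x"] arctan_le_self assms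
    by (auto simp: divide_le_eq)
qed

text \<open>Integration by parts of \<open>arctan x / x\<close> against
  \<open>ln (1 - x ^ 2)\<close>, with the value \<open>b\<close> left unknown. Taking
  \<open>Ti x - Ti 1\<close> as antiderivative makes the boundary term at 1 vanish.\<close>

lemma integral_geometric_Ti:
  assumes "((\<lambda>x. arctan x * ln (1 - x ^ 2) / x) has_integral b) {0..1}"
  shows "((\<lambda>x. 2 * x / (1 - x ^ 2) * (Ti 1 - Ti x)) has_integral - b) {0..1}"
proof -
  have "((\<lambda>x. arctan x * ln (1 - x ^ 2) / x + 2 * x / (1 - x ^ 2) * (Ti 1 - Ti x)) has_integral 0 - 0) {0..1}"
  proof (rule fundamental_theorem_of_calculus_limits)
    let ?F = "\<lambda>x. - (ln (1 - x ^ 2) * (Ti 1 - Ti x))"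
    show "(?F has_real_derivative arctan x * ln (1 - x ^ 2) / x + 2 * x / (1 - x ^ 2) * (Ti 1 - Ti x)) (at x)"
      if "0 < x" "x < 1" for x
    proof -
      have "1 - x ^ 2 > 0" using that by (simp add: power_less_one_iff)
      then have "(?F has_real_derivative - (1 / (1 - x ^ 2) * (- (2 * x)) * (Ti 1 - Ti x)
          + ln (1 - x ^ 2) * (0 - arctan x / x))) (at x)"
        using that by (auto intro!: derivative_eq_intros Ti_deriv)
      then show ?thesis
        by (rule DERIV_cong) (simp add: algebra_simps)
    qed
    have "(?F \<longlongrightarrow> - (ln (1 - 0 ^ 2) * (Ti 1 - 0))) (at_right 0)"
      by (intro tendsto_intros Ti_tendsto_0) auto
    then show "(?F \<longlongrightarrow> 0) (at_right 0)" by simp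
    show "(?F \<longlongrightarrow> 0) (at_left 1)"
    proof (rule Lim_null_comparison)
      show "\<forall>\<^sub>F x in at_left 1. norm (?F x) \<le> \<bar>ln (1 - x ^ 2)\<bar> * (1 - x)"
        using eventually_at_left_real[of 0 1]
      proof (rule eventually_mono)
        fix x :: real assume "x \<in> {0<..<1}"
        then show "norm (?F x) \<le> \<bar>ln (1 - x ^ 2)\<bar> * (1 - x)"
          using Ti_diff_bounds[of x] by (auto simp: abs_mult intro!: mult_left_mono)
      qed simp
      show "((\<lambda>x::real. \<bar>ln (1 - x ^ 2)\<bar> * (1 - x)) \<longlongrightarrow> 0) (at_left 1)"
        by real_asymp
    qed
  qed auto
  from has_integral_diff[OF this assms] show ?thesis by simp
qed

text \<open>The kernel is \<open>2 * x / (1 - x ^ 2)\<close> times \<open>- ln y\<close> times the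
  \<open>y\<close>-derivative of \<open>arctan y - arctan (x * y)\<close>. After cancelling
  \<open>1 - x\<close> it is regular at \<open>x = 1\<close> and visibly nonnegative.\<close>

lemma Tonelli_kernel_y:
  assumes x: "0 < x" "x < 1"
  shows "((\<lambda>y. - ln y * (2 * x * (1 - x * y ^ 2) / ((1 + x) * (1 + y ^ 2) * (1 + x ^ 2 * y ^ 2))))
     has_integral 2 * x / (1 - x ^ 2) * (Ti 1 - Ti x)) {0..1}"
proof -
  have "((\<lambda>y. - ln y * (1 / (1 + y ^ 2) - x / (1 + x ^ 2 * y ^ 2))) has_integral (Ti 1 - Ti x) - 0) {0..1}"
  proof (rule fundamental_theorem_of_calculus_limits)
    \<comment> \<open>Integration by parts: the remaining integrand
      \<open>(arctan y - arctan (x * y)) / y\<close> has the antiderivative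
      \<open>Ti y - Ti (x * y)\<close>.\<close>
    let ?F = "\<lambda>y. - (ln y * (arctan y - arctan (x * y))) + (Ti y - Ti (x * y))"
    show "(?F has_real_derivative - ln y * (1 / (1 + y ^ 2) - x / (1 + x ^ 2 * y ^ 2))) (at y)"
      if y: "0 < y" "y < 1" for y
    proof -
      have xy: "0 < x * y" "x * y < 1" using x y mult_strict_mono[of x 1 y 1] by auto
      have "((\<lambda>y. Ti (x * y)) has_real_derivative arctan (x * y) / (x * y) * x) (at y)"
        by (rule DERIV_chain2[of Ti _ "\<lambda>y. x * y", OF Ti_deriv[OF xy]]) (auto intro!: derivative_eq_intros)
      then have "(?F has_real_derivative - (1 / y * (arctan y - arctan (x * y))
          + ln y * (1 / (1 + y ^ 2) - x / (1 + (x * y) ^ 2)))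
          + (arctan y / y - arctan (x * y) / (x * y) * x)) (at y)"
        using y by (auto intro!: derivative_eq_intros Ti_deriv simp: divide_inverse)
      then show ?thesis
        by (rule DERIV_cong) (use x y in \<open>simp add: power_mult_distrib diff_divide_distrib\<close>)
    qed
    have "((\<lambda>y. ln y * arctan y) \<longlongrightarrow> 0) (at_right 0)" by real_asymp
    moreover have "((\<lambda>y. ln y * arctan (x * y)) \<longlongrightarrow> 0) (at_right 0)" using x by real_asymp
    moreover have "((\<lambda>y. Ti (x * y)) \<longlongrightarrow> 0) (at_right 0)"
    proof (rule filterlim_compose[OF Ti_tendsto_0])
      show "filterlim (\<lambda>y. x * y) (at_right 0) (at_right 0)" using x by real_asymp
    qed
    ultimately have "((\<lambda>y. - (ln y * arctan y - ln y * arctan (x * y)) + (Ti y - Ti (x * y))) \<longlongrightarrow> - (0 - 0) + (0 - 0)) (at_right 0)"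
      by (intro tendsto_add tendsto_minus tendsto_diff Ti_tendsto_0)
    then show "(?F \<longlongrightarrow> 0) (at_right 0)" by (simp add: algebra_simps)
    have "isCont Ti x" using Ti_deriv[OF x] DERIV_isCont by blast
    moreover have "((\<lambda>y. x * y) \<longlongrightarrow> x) (at_left 1)" by (auto intro!: tendsto_eq_intros)
    ultimately have "((\<lambda>y. Ti (x * y)) \<longlongrightarrow> Ti x) (at_left 1)" by (rule isCont_tendsto_compose)
    then have "(?F \<longlongrightarrow> - (ln 1 * (arctan 1 - arctan (x * 1))) + (Ti 1 - Ti x)) (at_left 1)"
      by (intro tendsto_intros Ti_tendsto_1) auto
    then show "(?F \<longlongrightarrow> Ti 1 - Ti x) (at_left 1)" by simp
  qed auto
  then have "((\<lambda>y. 2 * x / (1 - x ^ 2) * (- ln y * (1 / (1 + y ^ 2) - x / (1 + x ^ 2 * y ^ 2))))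
      has_integral 2 * x / (1 - x ^ 2) * (Ti 1 - Ti x - 0)) {0..1}"
    by (rule has_integral_mult_right)
  moreover have "2 * x / (1 - x ^ 2) * (- ln y * (1 / (1 + y ^ 2) - x / (1 + x ^ 2 * y ^ 2)))
      = - ln y * (2 * x * (1 - x * y ^ 2) / ((1 + x) * (1 + y ^ 2) * (1 + x ^ 2 * y ^ 2)))" for y
  proof -
    have nz: "1 + y ^ 2 \<noteq> 0" "1 + x ^ 2 * y ^ 2 \<noteq> 0" "1 - x \<noteq> 0" "1 + x \<noteq> 0"
      using x by (auto simp: add_nonneg_eq_0_iff)
    have "1 / (1 + y ^ 2) - x / (1 + x ^ 2 * y ^ 2) = (1 - x) * (1 - x * y ^ 2) / ((1 + y ^ 2) * (1 + x ^ 2 * y ^ 2))"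
      unfolding diff_frac_eq[OF nz(1,2)] by (simp add: algebra_simps power2_eq_square)
    moreover have "1 - x ^ 2 = (1 - x) * (1 + x)" by (simp add: algebra_simps power2_eq_square)
    ultimately show ?thesis using nz by (simp add: mult_ac)
  qed
  ultimately show ?thesis by simp
qed

text \<open>In the variable \<open>x\<close> the same kernel splits by partial fractions into an
  arctangent part and a logarithm part.\<close>

lemma Tonelli_kernel_x:
  assumes y: "0 < y" "y < 1"
  shows "((\<lambda>x. - ln y * (2 * x * (1 - x * y ^ 2) / ((1 + x) * (1 + y ^ 2) * (1 + x ^ 2 * y ^ 2))))
     has_integral - ln y / (1 + y ^ 2) * (2 * arctan y / y - 2 * ln 2)) {0..1}"
proof -
  have "((\<lambda>x. 2 / (1 + x ^ 2 * y ^ 2) - 2 / (1 + x)) has_integral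
      (2 * arctan (1 * y) / y - 2 * ln (1 + 1)) - (2 * arctan (0 * y) / y - 2 * ln (1 + 0))) {0..1}"
  proof (rule fundamental_theorem_of_calculus)
    fix x :: real assume x: "x \<in> {0..1}"
    have "((\<lambda>x. 2 * arctan (x * y) / y - 2 * ln (1 + x)) has_real_derivative
       2 * (inverse (1 + (x * y) ^ 2) * y) / y - 2 * (1 / (1 + x))) (at x within {0..1})"
      using x y by (auto intro!: derivative_eq_intros)
    then have "((\<lambda>x. 2 * arctan (x * y) / y - 2 * ln (1 + x)) has_real_derivative
       2 / (1 + x ^ 2 * y ^ 2) - 2 / (1 + x)) (at x within {0..1})"
      by (rule DERIV_cong) (use y in \<open>simp add: divide_inverse power_mult_distrib\<close>)
    then show "((\<lambda>x. 2 * arctan (x * y) / y - 2 * ln (1 + x)) has_vector_derivative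
       2 / (1 + x ^ 2 * y ^ 2) - 2 / (1 + x)) (at x within {0..1})"
      by (simp add: has_real_derivative_iff_has_vector_derivative)
  qed auto
  from has_integral_mult_right[OF this, of "- ln y / (1 + y ^ 2)"]
  have "((\<lambda>x. - ln y / (1 + y ^ 2) * (2 / (1 + x ^ 2 * y ^ 2) - 2 / (1 + x))) has_integral
      - ln y / (1 + y ^ 2) * (2 * arctan y / y - 2 * ln 2)) {0..1}"
    by simp
  then show ?thesis
  proof (rule has_integral_eq[rotated])
    fix x :: real assume "x \<in> {0..1}"
    then have nz: "1 + y ^ 2 \<noteq> 0" "1 + x ^ 2 * y ^ 2 \<noteq> 0" "1 + x \<noteq> 0"
      by (auto simp: add_nonneg_eq_0_iff)
    have "2 / (1 + x ^ 2 * y ^ 2) - 2 / (1 + x) = 2 * x * (1 - x * y ^ 2) / ((1 + x) * (1 + x ^ 2 * y ^ 2))"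
      unfolding diff_frac_eq[OF nz(2,3)] by (simp add: algebra_simps power2_eq_square)
    then show "- ln y / (1 + y ^ 2) * (2 / (1 + x ^ 2 * y ^ 2) - 2 / (1 + x))
      = - ln y * (2 * x * (1 - x * y ^ 2) / ((1 + x) * (1 + y ^ 2) * (1 + x ^ 2 * y ^ 2)))"
      by (simp add: mult_ac)
  qed
qed

text \<open>The two orders of integration of one kernel: integrating over \<open>y\<close> first
  leads to \<open>integral_geometric_Ti\<close>, integrating over \<open>x\<close> first gives the
  integrand claimed here.\<close>

lemma integral_ln_arctan_Tonelli:
  assumes "((\<lambda>x. arctan x * ln (1 - x ^ 2) / x) has_integral b) {0..1}"
  shows "((\<lambda>y. - ln y / (1 + y ^ 2) * (2 * arctan y / y - 2 * ln 2)) has_integral - b) {0..1}"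
proof (rule has_integral_Tonelli[OF _ _ _ _ _ integral_geometric_Ti[OF assms]])
  let ?M = "\<lambda>x y :: real. - ln y * (2 * x * (1 - x * y ^ 2) / ((1 + x) * (1 + y ^ 2) * (1 + x ^ 2 * y ^ 2)))"
  show "(\<lambda>(x, y). ?M x y) \<in> borel_measurable borel"
    unfolding borel_prod[symmetric] by measurable
  show "(\<lambda>y::real. - ln y / (1 + y ^ 2) * (2 * arctan y / y - 2 * ln 2)) \<in> borel_measurable borel"
    by measurable
  show "0 \<le> ?M x y" if "x \<in> {0<..<1}" "y \<in> {0<..<1}" for x y
  proof -
    have "x * y ^ 2 \<le> 1" using that by (intro mult_le_one) (auto simp: power_le_one)
    then show ?thesis
      using that by (intro mult_nonneg_nonneg divide_nonneg_nonneg add_nonneg_nonneg) (auto simp: ln_le_zero_iff)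
  qed
qed (use Tonelli_kernel_x Tonelli_kernel_y in auto)

section \<open>Linear relations between the remaining integrals\<close>

lemma integrals_arctan_ln:
  shows "(\<lambda>x::real. arctan x * ln (1 + x ^ 2) / x) integrable_on {0..1}"
    and "(\<lambda>x::real. ln x * ln (1 + x ^ 2) / (1 + x ^ 2)) integrable_on {0..1}"
    and "(\<lambda>x::real. arctan x / x) integrable_on {0..1}"
proof -
  have pos: "1 + x ^ 2 > 0" for x :: real by (simp add: add_pos_nonneg)
  show "(\<lambda>x::real. arctan x * ln (1 + x ^ 2) / x) integrable_on {0..1}"
  proof (rule integrable_on_limits)
    show "((\<lambda>x::real. arctan x * ln (1 + x ^ 2) / x) \<longlongrightarrow> 0) (at_right 0)" by real_asymp
    show "((\<lambda>x::real. arctan x * ln (1 + x ^ 2) / x) \<longlongrightarrow> arctan 1 * ln (1 + 1 ^ 2) / 1) (at_left 1)"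
      by (intro tendsto_intros) auto
    show "isCont (\<lambda>x. arctan x * ln (1 + x ^ 2) / x) x" if "0 < x" for x :: real
      using that pos[of x] by (intro continuous_intros) auto
  qed auto
  show "(\<lambda>x::real. ln x * ln (1 + x ^ 2) / (1 + x ^ 2)) integrable_on {0..1}"
  proof (rule integrable_on_limits)
    show "((\<lambda>x::real. ln x * ln (1 + x ^ 2) / (1 + x ^ 2)) \<longlongrightarrow> 0) (at_right 0)" by real_asymp
    show "((\<lambda>x::real. ln x * ln (1 + x ^ 2) / (1 + x ^ 2)) \<longlongrightarrow> ln 1 * ln (1 + 1 ^ 2) / (1 + 1 ^ 2)) (at_left 1)"
      by (intro tendsto_intros) auto
    show "isCont (\<lambda>x. ln x * ln (1 + x ^ 2) / (1 + x ^ 2)) x" if "0 < x" for x :: real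
      using that pos[of x] by (intro continuous_intros) auto
  qed auto
  show "(\<lambda>x::real. arctan x / x) integrable_on {0..1}"
  proof (rule integrable_on_limits)
    show "((\<lambda>x::real. arctan x / x) \<longlongrightarrow> 1) (at_right 0)" by real_asymp
    show "((\<lambda>x::real. arctan x / x) \<longlongrightarrow> arctan 1 / 1) (at_left 1)"
      by (intro tendsto_intros) auto
  qed (auto intro!: continuous_intros)
qed

text \<open>The product rule for \<open>ln (1 + x ^ 2) * ln x * arctan x / 2\<close>, which tends to
  0 at both ends, ties three integrals together.\<close>

lemma integral_ln_ln_arctan:
  "((\<lambda>x. x * ln x * arctan x / (1 + x ^ 2) + (arctan x * ln (1 + x ^ 2) / x) / 2
      + (ln x * ln (1 + x ^ 2) / (1 + x ^ 2)) / 2) has_integral 0 - 0) {0..1}"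
proof (rule fundamental_theorem_of_calculus_limits)
  have pos: "1 + x ^ 2 > 0" for x :: real by (simp add: add_pos_nonneg)
  let ?F = "\<lambda>x::real. ln (1 + x ^ 2) * ln x * arctan x / 2"
  show "(?F has_real_derivative x * ln x * arctan x / (1 + x ^ 2) + (arctan x * ln (1 + x ^ 2) / x) / 2
    + (ln x * ln (1 + x ^ 2) / (1 + x ^ 2)) / 2) (at x)" if "0 < x" for x
  proof -
    have "((\<lambda>x. ln (1 + x ^ 2)) has_real_derivative 2 * x / (1 + x ^ 2)) (at x)"
      using pos[of x] by (auto intro!: derivative_eq_intros)
    moreover have "(ln has_real_derivative 1 / x) (at x)"
      using that by (rule DERIV_ln_divide)
    ultimately have D: "(?F has_real_derivative ((2 * x / (1 + x ^ 2) * ln x + 1 / x * ln (1 + x ^ 2)) * arctan x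
        + inverse (1 + x ^ 2) * (ln (1 + x ^ 2) * ln x)) / 2) (at x)"
      by (intro DERIV_cdivide DERIV_mult DERIV_arctan)
    \<comment> \<open>The transcendental factors are abstracted to variables, so that clearing
      denominators is pure field arithmetic.\<close>
    have eq: "((2 * x / d * L + 1 / x * l) * a + inverse d * (l * L)) / 2
        = x * L * a / d + (a * l / x) / 2 + (L * l / d) / 2" if "d \<noteq> 0" for d L l a :: real
      using that \<open>0 < x\<close> by (simp add: field_simps)
    have "1 + x ^ 2 \<noteq> 0" using pos[of x] by simp
    from DERIV_cong[OF D eq[OF this]] show ?thesis .
  qed
  show "(?F \<longlongrightarrow> 0) (at_right 0)" by real_asymp
  have "(?F \<longlongrightarrow> ln (1 + 1 ^ 2) * ln 1 * arctan 1 / 2) (at_left 1)"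
    by (intro tendsto_intros) auto
  then show "(?F \<longlongrightarrow> 0) (at_left 1)" by simp
qed auto

lemma integral_ln_arctan_one_plus_square:
  assumes Y: "((\<lambda>x::real. arctan x * ln (1 + x ^ 2) / x) has_integral Y) {0..1}"
    and U: "((\<lambda>x::real. ln x * ln (1 + x ^ 2) / (1 + x ^ 2)) has_integral U) {0..1}"
  shows "((\<lambda>x. x * ln x * arctan x / (1 + x ^ 2)) has_integral - Y / 2 - U / 2) {0..1}"
proof -
  have "((\<lambda>x. (x * ln x * arctan x / (1 + x ^ 2) + (arctan x * ln (1 + x ^ 2) / x) / 2
      + (ln x * ln (1 + x ^ 2) / (1 + x ^ 2)) / 2) - (arctan x * ln (1 + x ^ 2) / x) / 2
      - (ln x * ln (1 + x ^ 2) / (1 + x ^ 2)) / 2) has_integral 0 - 0 - Y / 2 - U / 2) {0..1}"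
    by (intro has_integral_diff integral_ln_ln_arctan has_integral_divide Y U)
  moreover have "(u + v + w) - v - w = u" for u v w :: real by simp
  ultimately have "((\<lambda>x. x * ln x * arctan x / (1 + x ^ 2)) has_integral 0 - 0 - Y / 2 - U / 2) {0..1}"
    by (simp only:)
  then show ?thesis by simp
qed

text \<open>The integrals \<open>Y\<close>, \<open>U\<close> and \<open>G\<close> are never
  evaluated. The exchanged integral gives \<open>K\<close> as \<open>Y - U - 2 * ln 2 * G\<close>
  plus \<open>pi ^ 3 / 16\<close>, and the contour gives \<open>- (pi ^ 3 / 32)\<close> for the same
  combination.\<close>

lemma integral_arctan_ln_value:
  assumes K: "((\<lambda>x. arctan x * (2 * ln (1 + x ^ 2) - ln (1 - x ^ 2)) / x) has_integral K) {0..1}"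
  shows "K = pi ^ 3 / 32"
proof -
  obtain Y where Y: "((\<lambda>x::real. arctan x * ln (1 + x ^ 2) / x) has_integral Y) {0..1}"
    using integrals_arctan_ln(1) by blast
  obtain U where U: "((\<lambda>x::real. ln x * ln (1 + x ^ 2) / (1 + x ^ 2)) has_integral U) {0..1}"
    using integrals_arctan_ln(2) by blast
  \<comment> \<open>\<open>G\<close> is Catalan's constant; it occurs only with the factor
    \<open>2 * ln 2\<close> and cancels.\<close>
  obtain G where G: "((\<lambda>x::real. arctan x / x) has_integral G) {0..1}"
    using integrals_arctan_ln(3) by blast
  have pos: "1 + x ^ 2 > 0" for x :: real by (simp add: add_pos_nonneg)
  have "((\<lambda>x. 2 * (arctan x * ln (1 + x ^ 2) / x) - arctan x * (2 * ln (1 + x ^ 2) - ln (1 - x ^ 2)) / x)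
      has_integral 2 * Y - K) {0..1}"
    by (intro has_integral_diff has_integral_mult_right Y K)
  then have "((\<lambda>x. arctan x * ln (1 - x ^ 2) / x) has_integral 2 * Y - K) {0..1}"
    by (simp add: algebra_simps diff_divide_distrib)
  from integral_ln_arctan_Tonelli[OF this]
  have 1: "((\<lambda>y. - ln y / (1 + y ^ 2) * (2 * arctan y / y - 2 * ln 2)) has_integral K - 2 * Y) {0..1}"
    by simp
  have "((\<lambda>x. arctan x / x + ln x / (1 + x ^ 2)) has_integral 0 - 0) {0..1}"
  proof (rule fundamental_theorem_of_calculus_limits)
    show "((\<lambda>x. ln x * arctan x) has_real_derivative arctan x / x + ln x / (1 + x ^ 2)) (at x)" if "0 < x" for x
      using that pos[of x] by (auto intro!: derivative_eq_intros simp: field_simps)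
    show "((\<lambda>x::real. ln x * arctan x) \<longlongrightarrow> 0) (at_right 0)" by real_asymp
    have "((\<lambda>x::real. ln x * arctan x) \<longlongrightarrow> ln 1 * arctan 1) (at_left 1)"
      by (intro tendsto_intros) auto
    then show "((\<lambda>x::real. ln x * arctan x) \<longlongrightarrow> 0) (at_left 1)" by simp
  qed auto
  from has_integral_diff[OF this G]
  have 2: "((\<lambda>x. ln x / (1 + x ^ 2)) has_integral - G) {0..1}" by simp
  note 3 = integral_ln_arctan_one_plus_square[OF Y U]
  have 4: "((\<lambda>t::real. pi * (arctan t / (1 + t ^ 2))) has_integral pi * ((arctan 1) ^ 2 / 2 - (arctan 0) ^ 2 / 2)) {0..1}"
  proof (intro has_integral_mult_right fundamental_theorem_of_calculus)
    fix t :: real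
    show "((\<lambda>t. (arctan t) ^ 2 / 2) has_vector_derivative arctan t / (1 + t ^ 2)) (at t within {0..1})"
      unfolding has_real_derivative_iff_has_vector_derivative[symmetric]
      using pos[of t] by (auto intro!: derivative_eq_intros simp: field_simps)
  qed auto
  have "((\<lambda>t. arctan t * ln (1 + t ^ 2) / t - 2 * ln 2 * (arctan t / t) - ln t * ln (1 + t ^ 2) / (1 + t ^ 2)
     + pi * (arctan t / (1 + t ^ 2))) has_integral Y - 2 * ln 2 * G - U + pi * ((arctan 1) ^ 2 / 2 - (arctan 0) ^ 2 / 2)) {0..1}"
    by (intro has_integral_add has_integral_diff has_integral_mult_right Y G U 4)
  moreover have "arctan t * ln (1 + t ^ 2) / t - 2 * ln 2 * (arctan t / t) - ln t * ln (1 + t ^ 2) / (1 + t ^ 2)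
     + pi * (arctan t / (1 + t ^ 2)) = arctan t * (ln (1 + t ^ 2) - 2 * ln 2) / t - ln t * ln (1 + t ^ 2) / (1 + t ^ 2)
     + pi * arctan t / (1 + t ^ 2)" for t :: real
    by (simp add: right_diff_distrib diff_divide_distrib)
  ultimately have "((\<lambda>t. arctan t * (ln (1 + t ^ 2) - 2 * ln 2) / t - ln t * ln (1 + t ^ 2) / (1 + t ^ 2)
     + pi * arctan t / (1 + t ^ 2)) has_integral Y - 2 * ln 2 * G - U + pi * ((arctan 1) ^ 2 / 2 - (arctan 0) ^ 2 / 2)) {0..1}"
    by (simp only:)
  from has_integral_unique[OF this integral_contour_fn_boundary]
  have 5: "Y - 2 * ln 2 * G - U + pi * ((arctan 1) ^ 2 / 2 - (arctan 0) ^ 2 / 2) = 0" .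
  have "((\<lambda>y. 2 * (y * ln y * arctan y / (1 + y ^ 2)) - 2 * (ln y * arctan y / y) + 2 * ln 2 * (ln y / (1 + y ^ 2)))
      has_integral 2 * (- Y / 2 - U / 2) - 2 * (- (pi ^ 3 / 32)) + 2 * ln 2 * (- G)) {0..1}"
    by (intro has_integral_add has_integral_diff has_integral_mult_right 2 3 integral_ln_arctan_div)
  then have "((\<lambda>y. - ln y / (1 + y ^ 2) * (2 * arctan y / y - 2 * ln 2))
      has_integral 2 * (- Y / 2 - U / 2) - 2 * (- (pi ^ 3 / 32)) + 2 * ln 2 * (- G)) {0..1}"
  proof (rule has_integral_spike_finite[of "{0}", rotated 2])
    fix y :: real assume "y \<in> {0..1} - {0}"
    moreover have "- l / d * (2 * a / y - 2 * c) = 2 * (y * l * a / d) - 2 * (l * a / y) + 2 * c * (l / d)"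
      if "y \<noteq> 0" "d \<noteq> 0" "d = 1 + y ^ 2" for l a c d :: real
    proof -
      \<comment> \<open>This partial fraction splits the exchanged integrand into the pieces
        evaluated in \<open>integral_ln_arctan_div\<close> and in \<open>3\<close>.\<close>
      have "1 / (d * y) = 1 / y - y / d"
        using that by (simp add: field_simps power2_eq_square)
      then have "- (2 * l * a) * (1 / (d * y)) + 2 * c * (l / d) = - (2 * l * a) * (1 / y - y / d) + 2 * c * (l / d)"
        by simp
      then show ?thesis by (simp add: algebra_simps)
    qed
    ultimately show "- ln y / (1 + y ^ 2) * (2 * arctan y / y - 2 * ln 2) = 2 * (y * ln y * arctan y / (1 + y ^ 2))
        - 2 * (ln y * arctan y / y) + 2 * ln 2 * (ln y / (1 + y ^ 2))"
      using pos[of y] by (metis DiffD2 insertI1 less_irrefl)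
  qed auto
  from has_integral_unique[OF this 1]
  have "2 * (- Y / 2 - U / 2) - 2 * (- (pi ^ 3 / 32)) + 2 * ln 2 * (- G) = K - 2 * Y" .
  with 5 show ?thesis
    by (simp add: arctan_one power_divide power2_eq_square power3_eq_cube)
qed

subsection \<open>The closed forms\<close>

text \<open>Integration by parts with \<open>arctan\<close> gives \<open>J\<close> as
  \<open>pi ^ 3 / 24\<close> minus the integral just evaluated, and the moment relation for index 0
  passes from \<open>J\<close> to \<open>S 0\<close>.\<close>

lemma S_0: "S 0 = 2 - pi + pi ^ 2 / 6 - pi ^ 3 / 96"
proof -
  define J where "J = integral {0..1} (\<lambda>t. 1 / (1 + t ^ 2) * S_gen (t ^ 2))"
  have pos: "1 + x ^ 2 > 0" for x :: real by (simp add: add_pos_nonneg)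
  have J: "((\<lambda>t. 1 / (1 + t ^ 2) * S_gen (t ^ 2)) has_integral J) {0..1}"
    unfolding J_def using S_integrable[of 0] by (intro integrable_integral) simp
  have "((\<lambda>t. 1 / (1 + t ^ 2) * S_gen (t ^ 2) + arctan t * (2 * ln (1 + t ^ 2) - ln (1 - t ^ 2)) / t)
      has_integral pi / 4 * (pi ^ 2 / 6) - 0) {0..1}"
  proof (rule fundamental_theorem_of_calculus_limits)
    show "((\<lambda>t. arctan t * S_gen (t ^ 2)) has_real_derivative
       1 / (1 + t ^ 2) * S_gen (t ^ 2) + arctan t * (2 * ln (1 + t ^ 2) - ln (1 - t ^ 2)) / t) (at t)"
      if "0 < t" "t < 1" for t
    proof (rule DERIV_cong[OF DERIV_mult[OF DERIV_arctan S_gen_sq_deriv[OF that]]])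
      show "inverse (1 + t ^ 2) * S_gen (t ^ 2) + (2 * ln (1 + t ^ 2) - ln (1 - t ^ 2)) / t * arctan t
        = 1 / (1 + t ^ 2) * S_gen (t ^ 2) + arctan t * (2 * ln (1 + t ^ 2) - ln (1 - t ^ 2)) / t"
        by (simp add: divide_inverse mult_ac)
    qed
    have "((\<lambda>t. arctan t * S_gen (t ^ 2)) \<longlongrightarrow> arctan 0 * S_gen 0) (at_right 0)"
      by (intro tendsto_intros S_gen_sq_tendsto)
    then show "((\<lambda>t. arctan t * S_gen (t ^ 2)) \<longlongrightarrow> 0) (at_right 0)" by simp
    have "((\<lambda>t. arctan t * S_gen (t ^ 2)) \<longlongrightarrow> arctan 1 * (pi ^ 2 / 6)) (at_left 1)"
      by (intro tendsto_intros S_gen_sq_tendsto)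
    then show "((\<lambda>t. arctan t * S_gen (t ^ 2)) \<longlongrightarrow> pi / 4 * (pi ^ 2 / 6)) (at_left 1)"
      by (simp add: arctan_one)
  qed auto
  from has_integral_diff[OF this J]
  have "((\<lambda>t. arctan t * (2 * ln (1 + t ^ 2) - ln (1 - t ^ 2)) / t) has_integral pi ^ 3 / 24 - J) {0..1}"
    by (simp add: power2_eq_square power3_eq_cube mult.assoc)
  from integral_arctan_ln_value[OF this] have "J = pi ^ 3 / 96" by simp
  moreover have "J + S 0 = S_gen_moment 0"
    using integral_power_div_S_gen_add[of 0] by (simp add: J_def S_eq_integral)
  moreover have "S_gen_moment 0 = pi ^ 2 / 6 + 2 - pi"
    by (simp add: S_gen_moment_def beta_int_0 harm_expand)
  ultimately show ?thesis by simp
qed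

text \<open>With \<open>a\<close> and \<open>b\<close> the consecutive odd denominators, the
  harmonic increment \<open>2 / b\<close> and the \<open>4 / b\<close> from the recurrence of
  \<open>beta_int\<close> combine to the cubic term.\<close>

lemma S_gen_moment_Suc_minus:
  "S_gen_moment (Suc m) - S_gen_moment m = - (pi ^ 2 / (3 * (2 * real m + 1) * (2 * real m + 3)))
     + (2 * harm (2 * m + 1) - harm m) * (8 * (real m + 1)) / ((2 * real m + 1) ^ 2 * (2 * real m + 3) ^ 2)
     + 2 / (2 * real m + 3) ^ 3
     - beta_int m * (1 / (2 * real m + 3) ^ 2 + 1 / (2 * real m + 1) ^ 2)"
proof -
  define a where "a = 2 * real m + 1"
  define b where "b = 2 * real m + 3"
  have a: "a > 0" and b: "b > 0" and ba: "b = a + 2" by (auto simp: a_def b_def)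
  have harm: "2 * harm (2 * Suc m + 1) - harm (Suc m) = 2 * harm (2 * m + 1) - harm m + 2 / b"
    by (simp add: harm_Suc inverse_eq_divide b_def divide_simps) (simp add: algebra_simps)
  have beta: "beta_int (Suc m) = 4 / b - beta_int m"
    using beta_int_Suc[of m] by (simp add: b_def)
  define h :: real where "h = 2 * harm (2 * m + 1) - harm m"
  have "S_gen_moment (Suc m) - S_gen_moment m =
      pi ^ 2 / 6 * (1 / b - 1 / a) + h * (1 / a ^ 2 - 1 / b ^ 2) + (4 / b - 2 / b) / b ^ 2
      - beta_int m * (1 / b ^ 2 + 1 / a ^ 2)"
  proof -
    have "2 * real (Suc m) + 1 = b" by (simp add: b_def)
    then show ?thesis
      unfolding S_gen_moment_def harm beta h_def[symmetric] a_def[symmetric]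
      by (simp add: algebra_simps add_divide_distrib diff_divide_distrib)
  qed
  also have "1 / b - 1 / a = - 2 / (a * b)"
    using a b by (simp add: ba field_simps)
  also have "1 / a ^ 2 - 1 / b ^ 2 = 8 * (real m + 1) / (a ^ 2 * b ^ 2)"
  proof -
    have "b ^ 2 - a ^ 2 = 8 * (real m + 1)" by (simp add: a_def b_def power2_eq_square algebra_simps)
    then show ?thesis using a b by (simp add: diff_frac_eq)
  qed
  also have "(4 / b - 2 / b) / b ^ 2 = 2 / b ^ 3"
    using b by (simp add: field_simps power2_eq_square power3_eq_cube)
  finally show ?thesis
    unfolding a_def[symmetric] b_def[symmetric] h_def[symmetric] by (simp add: mult_ac)
qed

text \<open>Two steps of the alternating recurrence restore the sign of \<open>S n\<close>; this is
  why the closed forms split by parity.\<close>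

lemma S_Suc_Suc: "S (Suc (Suc n)) = S n + (S_gen_moment (Suc (Suc n)) - S_gen_moment (Suc n))"
  by (simp add: S_Suc)

text \<open>Each induction step adds one moment difference at the odd index
  \<open>2 * m + 1\<close>. There \<open>beta_int\<close> equals \<open>pi\<close> minus a Leibniz
  partial sum, which fixes the signs of the \<open>pi\<close> term and of the double sum.\<close>

lemma S_even:
  "S (2 * m) = 2
        + 16 * (\<Sum>j < m.
            (real j + 1) * (2 * harm (4 * j + 3) - harm (2 * j + 1))
              / ((4 * real j + 5) ^ 2 * (4 * real j + 3) ^ 2))
        + 2 * (\<Sum>j < m. 1 / (4 * real j + 5) ^ 3)
        + 8 * (\<Sum>k < m. \<Sum>j = 0..2 * k + 1.
            (- 1) ^ j * (16 * real k ^ 2 + 32 * real k + 17)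
              / ((2 * real j + 1) * (4 * real k + 5) ^ 2 * (4 * real k + 3) ^ 2))
        - (1 + (\<Sum>j < m.
            2 * (16 * real j ^ 2 + 32 * real j + 17)
              / ((4 * real j + 5) ^ 2 * (4 * real j + 3) ^ 2))) * pi
        + (1 / 2 - (\<Sum>j < m.
            1 / ((4 * real j + 5) * (4 * real j + 3)))) * (pi ^ 2 / 3)
        - pi ^ 3 / 96"
proof (induction m)
  case 0
  then show ?case by (simp add: S_0)
next
  case (Suc m)
  define b where "b = 4 * real m + 5"
  define a where "a = 4 * real m + 3"
  \<comment> \<open>Half of \<open>a ^ 2 + b ^ 2\<close>, the numerator that arises when the two
    inverse squares are added.\<close>
  define q where "q = 16 * real m ^ 2 + 32 * real m + 17"
  define h :: real where "h = 2 * harm (4 * m + 3) - harm (2 * m + 1)"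
  define s where "s = (\<Sum>j\<le>2 * m + 1. (- 1) ^ j / (2 * real j + 1))"
  have a: "a > 0" and b: "b > 0" by (auto simp: a_def b_def)
  have beta: "beta_int (Suc (2 * m)) = pi - 4 * s"
    using beta_int_eq[of "Suc (2 * m)"] by (simp add: s_def)
  have sum: "(\<Sum>j = 0..2 * m + 1. (- 1) ^ j * q / ((2 * real j + 1) * b ^ 2 * a ^ 2)) = s * (q / (a ^ 2 * b ^ 2))"
    unfolding s_def atLeast0AtMost sum_distrib_right by (intro sum.cong) (auto simp: mult_ac)
  have "S (2 * Suc m) = S (2 * m) + (S_gen_moment (Suc (Suc (2 * m))) - S_gen_moment (Suc (2 * m)))"
    using S_Suc_Suc[of "2 * m"] by simp
  also have "S_gen_moment (Suc (Suc (2 * m))) - S_gen_moment (Suc (2 * m)) = - (pi ^ 2 / (3 * a * b))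
      + h * (16 * (real m + 1)) / (a ^ 2 * b ^ 2) + 2 / b ^ 3 - (pi - 4 * s) * (1 / b ^ 2 + 1 / a ^ 2)"
  proof -
    have eqs: "2 * real (Suc (2 * m)) + 1 = a" "2 * real (Suc (2 * m)) + 3 = b"
      "8 * (real (Suc (2 * m)) + 1) = 16 * (real m + 1)" "2 * Suc (2 * m) + 1 = 4 * m + 3"
      by (auto simp: a_def b_def)
    show ?thesis
      unfolding S_gen_moment_Suc_minus beta h_def eqs by simp
  qed
  also have "1 / b ^ 2 + 1 / a ^ 2 = 2 * q / (a ^ 2 * b ^ 2)"
  proof -
    have "a ^ 2 + b ^ 2 = 2 * q" by (simp add: a_def b_def q_def power2_eq_square algebra_simps)
    then show ?thesis using a b by (simp add: add_frac_eq add.commute mult.commute)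
  qed
  finally have step: "S (2 * Suc m) = S (2 * m) + (- (pi ^ 2 / (3 * a * b))
      + h * (16 * (real m + 1)) / (a ^ 2 * b ^ 2) + 2 / b ^ 3 - (pi - 4 * s) * (2 * q / (a ^ 2 * b ^ 2)))" .
  show ?case
    unfolding step Suc.IH sum.lessThan_Suc a_def[symmetric] b_def[symmetric] q_def[symmetric] h_def[symmetric] sum
    by (simp add: algebra_simps add_divide_distrib diff_divide_distrib)
qed

text \<open>The base case is \<open>S 1 = S_gen_moment 1 - S 0\<close>. The steps use even indices
  of \<open>beta_int\<close>, so the \<open>pi\<close> term and the double sum have signs opposite
  to those in \<open>S_even\<close>.\<close>

lemma S_odd:
  "S (2 * m + 1) = - (70 / 27)
        + 8 * (\<Sum>j = 1..m.
            (2 * real j + 1) * (2 * harm (4 * j + 1) - harm (2 * j))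
              / ((4 * real j + 3) ^ 2 * (4 * real j + 1) ^ 2))
        + 2 * (\<Sum>j = 1..m. 1 / (4 * real j + 3) ^ 3)
        - 8 * (\<Sum>k = 1..m. \<Sum>j = 0..2 * k.
            (- 1) ^ j * (16 * real k ^ 2 + 16 * real k + 5)
              / ((2 * real j + 1) * (4 * real k + 3) ^ 2 * (4 * real k + 1) ^ 2))
        + (10 / 9 + (\<Sum>j = 1..m.
            2 * (16 * real j ^ 2 + 16 * real j + 5)
              / ((4 * real j + 3) ^ 2 * (4 * real j + 1) ^ 2))) * pi
        - (1 / 3 + (\<Sum>j = 1..m.
            1 / ((4 * real j + 3) * (4 * real j + 1)))) * (pi ^ 2 / 3)
        + pi ^ 3 / 96"
proof (induction m)
  case 0
  have "S_gen_moment 1 = pi ^ 2 / 18 - (2 * (1 + 1 / 2 + 1 / 3) - 1 - (- (4 * (1 - 1 / 3) - pi))) / 9"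
    using beta_int_eq[of 1] by (simp add: S_gen_moment_def harm_expand)
  then show ?case using S_Suc[of 0] S_0 by (simp add: field_simps)
next
  case (Suc n)
  \<comment> \<open>The sums start at 1, so the summand added in this step has index
    \<open>Suc n\<close>.\<close>
  define m where "m = Suc n"
  define b where "b = 4 * real m + 3"
  define a where "a = 4 * real m + 1"
  define q where "q = 16 * real m ^ 2 + 16 * real m + 5"
  define h :: real where "h = 2 * harm (4 * m + 1) - harm (2 * m)"
  define s where "s = (\<Sum>j\<le>2 * m. (- 1) ^ j / (2 * real j + 1))"
  have a: "a > 0" and b: "b > 0" by (auto simp: a_def b_def)
  have beta: "beta_int (2 * m) = 4 * s - pi"
    using beta_int_eq[of "2 * m"] by (simp add: s_def)
  have sum: "(\<Sum>j = 0..2 * m. (- 1) ^ j * q / ((2 * real j + 1) * b ^ 2 * a ^ 2)) = s * (q / (a ^ 2 * b ^ 2))"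
    unfolding s_def atLeast0AtMost sum_distrib_right by (intro sum.cong) (auto simp: mult_ac)
  have "S (2 * m + 1) = S (2 * n + 1) + (S_gen_moment (Suc (2 * m)) - S_gen_moment (2 * m))"
    using S_Suc_Suc[of "2 * n + 1"] by (simp add: m_def)
  also have "S_gen_moment (Suc (2 * m)) - S_gen_moment (2 * m) = - (pi ^ 2 / (3 * a * b))
      + h * (8 * (2 * real m + 1)) / (a ^ 2 * b ^ 2) + 2 / b ^ 3 - (4 * s - pi) * (1 / b ^ 2 + 1 / a ^ 2)"
  proof -
    have eqs: "2 * real (2 * m) + 1 = a" "2 * real (2 * m) + 3 = b"
      "8 * (real (2 * m) + 1) = 8 * (2 * real m + 1)" "2 * (2 * m) + 1 = 4 * m + 1"
      by (auto simp: a_def b_def)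
    show ?thesis
      unfolding S_gen_moment_Suc_minus beta h_def eqs by simp
  qed
  also have "1 / b ^ 2 + 1 / a ^ 2 = 2 * q / (a ^ 2 * b ^ 2)"
  proof -
    have "a ^ 2 + b ^ 2 = 2 * q" by (simp add: a_def b_def q_def power2_eq_square algebra_simps)
    then show ?thesis using a b by (simp add: add_frac_eq add.commute mult.commute)
  qed
  finally have step: "S (2 * m + 1) = S (2 * n + 1) + (- (pi ^ 2 / (3 * a * b))
      + h * (8 * (2 * real m + 1)) / (a ^ 2 * b ^ 2) + 2 / b ^ 3 - (4 * s - pi) * (2 * q / (a ^ 2 * b ^ 2)))" .
  have split: "(\<Sum>j = 1..m. f j) = (\<Sum>j = 1..n. f j) + f m" for f :: "nat \<Rightarrow> real"
    by (simp add: m_def)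
  show ?case
    unfolding m_def[symmetric] step Suc.IH split a_def[symmetric] b_def[symmetric] q_def[symmetric] h_def[symmetric] sum
    by (simp add: algebra_simps add_divide_distrib diff_divide_distrib)
qed

text \<open>Summability is asserted as well because \<open>suminf\<close> is total: it ensures that
  \<open>S n\<close> is the sum of a convergent series.\<close>

theorem theorem10:
  fixes n :: nat
  shows "summable (\<lambda>k. S_term n (Suc k)) \<and>
    (n = 0 \<longrightarrow> S n = 2 - pi + pi ^ 2 / 6 - pi ^ 3 / 96) \<and>
    (n = 1 \<longrightarrow> S n = - (70 / 27) + 10 * pi / 9 - pi ^ 2 / 9 + pi ^ 3 / 96) \<and>
    (odd n \<and> n \<noteq> 1 \<longrightarrow>
      S n = - (70 / 27)
        + 8 * (\<Sum>j = 1..(n - 1) div 2.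
            (2 * real j + 1) * (2 * harm (4 * j + 1) - harm (2 * j))
              / ((4 * real j + 3) ^ 2 * (4 * real j + 1) ^ 2))
        + 2 * (\<Sum>j = 1..(n - 1) div 2. 1 / (4 * real j + 3) ^ 3)
        - 8 * (\<Sum>k = 1..(n - 1) div 2. \<Sum>j = 0..2 * k.
            (- 1) ^ j * (16 * real k ^ 2 + 16 * real k + 5)
              / ((2 * real j + 1) * (4 * real k + 3) ^ 2 * (4 * real k + 1) ^ 2))
        + (10 / 9 + (\<Sum>j = 1..(n - 1) div 2.
            2 * (16 * real j ^ 2 + 16 * real j + 5)
              / ((4 * real j + 3) ^ 2 * (4 * real j + 1) ^ 2))) * pi
        - (1 / 3 + (\<Sum>j = 1..(n - 1) div 2.
            1 / ((4 * real j + 3) * (4 * real j + 1)))) * (pi ^ 2 / 3)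
        + pi ^ 3 / 96) \<and>
    (even n \<longrightarrow>
      S n = 2
        + 16 * (\<Sum>j < n div 2.
            (real j + 1) * (2 * harm (4 * j + 3) - harm (2 * j + 1))
              / ((4 * real j + 5) ^ 2 * (4 * real j + 3) ^ 2))
        + 2 * (\<Sum>j < n div 2. 1 / (4 * real j + 5) ^ 3)
        + 8 * (\<Sum>k < n div 2. \<Sum>j = 0..2 * k + 1.
            (- 1) ^ j * (16 * real k ^ 2 + 32 * real k + 17)
              / ((2 * real j + 1) * (4 * real k + 5) ^ 2 * (4 * real k + 3) ^ 2))
        - (1 + (\<Sum>j < n div 2.
            2 * (16 * real j ^ 2 + 32 * real j + 17)
              / ((4 * real j + 5) ^ 2 * (4 * real j + 3) ^ 2))) * pi
        + (1 / 2 - (\<Sum>j < n div 2.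
            1 / ((4 * real j + 5) * (4 * real j + 3)))) * (pi ^ 2 / 3)
        - pi ^ 3 / 96)"
proof (intro conjI impI)
  show "summable (\<lambda>k. S_term n (Suc k))"
    using S_term_sums by (rule sums_summable)
  show "S n = 2 - pi + pi ^ 2 / 6 - pi ^ 3 / 96" if "n = 0"
    using that S_0 by simp
  show "S n = - (70 / 27) + 10 * pi / 9 - pi ^ 2 / 9 + pi ^ 3 / 96" if "n = 1"
    using that S_odd[of 0] by simp
next
  assume "odd n \<and> n \<noteq> 1"
  then have "n = 2 * ((n - 1) div 2) + 1" by (auto elim!: oddE)
  then show "S n = - (70 / 27)
        + 8 * (\<Sum>j = 1..(n - 1) div 2.
            (2 * real j + 1) * (2 * harm (4 * j + 1) - harm (2 * j))
              / ((4 * real j + 3) ^ 2 * (4 * real j + 1) ^ 2))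
        + 2 * (\<Sum>j = 1..(n - 1) div 2. 1 / (4 * real j + 3) ^ 3)
        - 8 * (\<Sum>k = 1..(n - 1) div 2. \<Sum>j = 0..2 * k.
            (- 1) ^ j * (16 * real k ^ 2 + 16 * real k + 5)
              / ((2 * real j + 1) * (4 * real k + 3) ^ 2 * (4 * real k + 1) ^ 2))
        + (10 / 9 + (\<Sum>j = 1..(n - 1) div 2.
            2 * (16 * real j ^ 2 + 16 * real j + 5)
              / ((4 * real j + 3) ^ 2 * (4 * real j + 1) ^ 2))) * pi
        - (1 / 3 + (\<Sum>j = 1..(n - 1) div 2.
            1 / ((4 * real j + 3) * (4 * real j + 1)))) * (pi ^ 2 / 3)
        + pi ^ 3 / 96"
    using S_odd[of "(n - 1) div 2"] by simp
next
  assume "even n"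
  then have "n = 2 * (n div 2)" by simp
  then show "S n = 2
        + 16 * (\<Sum>j < n div 2.
            (real j + 1) * (2 * harm (4 * j + 3) - harm (2 * j + 1))
              / ((4 * real j + 5) ^ 2 * (4 * real j + 3) ^ 2))
        + 2 * (\<Sum>j < n div 2. 1 / (4 * real j + 5) ^ 3)
        + 8 * (\<Sum>k < n div 2. \<Sum>j = 0..2 * k + 1.
            (- 1) ^ j * (16 * real k ^ 2 + 32 * real k + 17)
              / ((2 * real j + 1) * (4 * real k + 5) ^ 2 * (4 * real k + 3) ^ 2))
        - (1 + (\<Sum>j < n div 2.
            2 * (16 * real j ^ 2 + 32 * real j + 17)
              / ((4 * real j + 5) ^ 2 * (4 * real j + 3) ^ 2))) * pi
        + (1 / 2 - (\<Sum>j < n div 2.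
            1 / ((4 * real j + 5) * (4 * real j + 3)))) * (pi ^ 2 / 3)
        - pi ^ 3 / 96"
    using S_even[of "n div 2"] by simp
qed

end
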